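(* Let $G$ be a compact connected Lie group and let $\lambda$ be a dominant weight in the open Weyl chamber $C$. Then the probability measures $$m_{\lambda,N}=\frac{1}{(\dim V_\lambda)^{N}}\sum_{\nu\in Q(N\lambda)\cap I^*} m_N(\lambda;\nu)\,\delta_{N^{-1}\nu}$$ converge weakly, as $N\to\infty$, to the Dirac measure $\delta_{Q^*(\lambda)}$ at the point $$Q^*(\lambda)=\frac{1}{\dim V_\lambda}\sum_{\nu\in M_\lambda} m_1(\lambda;\nu)\,\nu .$$
   Context: Let $T\subset G$ be a maximal torus with Lie algebra $\mathfrak t$, $I=\exp^{-1}(1)\subset\mathfrak t$ the integral lattice, and $I^*\subset\mathfrak t^*$ the dual lattice (lattice of weights; $\mu\in I^*$ corresponds to the character $\exp H\mapsto e^{2\pi i\langle\mu,H\rangle}$ of $T$). $W$ is the Weyl group and $C\subset\mathfrak t^*$ is a fixed open Weyl chamber, with closure $\overline C$; dominant weights are the elements of $I^*\cap\overline C$. For a dominant weight $\lambda$, $V_\lambda$ is the irreducible representation of $G$ with highest weight $\lambda$; $m_N(\lambda;\nu)$ is the multiplicity of the weight $\nu$ in the tensor power $V_\lambda^{\otimes N}$ (so $m_1(\lambda;\nu)$ is its multiplicity in $V_\lambda$); $M_\lambda=\{\mu\in I^*: m_1(\lambda;\mu)\neq0\}$; $Q(\lambda)\subset\mathfrak t^*$ is the convex hull of the Weyl orbit $W\lambda$, and $Q(N\lambda)=NQ(\lambda)$. $\delta_x$ denotes the Dirac measure at $x$. *)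

theory Defs
  imports "HOL-Probability.Probability" "HOL-Algebra.Group_Action" "Jordan_Normal_Form.VS_Connect"
begin

unbundle no vec_syntax

section \<open>Lie groups\<close>

text \<open>
  Coordinates in \<open>R^n\<close> are functions \<open>x :: nat \<Rightarrow> real\<close> with \<open>x i = 0\<close> for \<open>i \<ge> n\<close>, as in
  \<^const>\<open>Euclidean_space\<close>; this keeps the dimension a natural number, with \<open>n = 0\<close> allowed.
\<close>

definition partial_deriv :: "nat \<Rightarrow> ((nat \<Rightarrow> real) \<Rightarrow> real) \<Rightarrow> (nat \<Rightarrow> real) \<Rightarrow> real" where
  "partial_deriv i f x = deriv (\<lambda>t. f (x(i := t))) (x i)"

primrec C_k_on :: "nat \<Rightarrow> nat \<Rightarrow> (nat \<Rightarrow> real) set \<Rightarrow> ((nat \<Rightarrow> real) \<Rightarrow> real) \<Rightarrow> bool" where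
  "C_k_on n 0 S f \<longleftrightarrow> continuous_map (subtopology (Euclidean_space n) S) euclideanreal f"
| "C_k_on n (Suc k) S f \<longleftrightarrow>
     continuous_map (subtopology (Euclidean_space n) S) euclideanreal f \<and>
     (\<forall>i<n. (\<forall>x\<in>S. (\<lambda>t. f (x(i := t))) differentiable (at (x i))) \<and>
            C_k_on n k S (partial_deriv i f))"

text \<open>Used only for \<open>S\<close> open in \<open>R^m\<close>.\<close>

definition smooth_map_on ::
    "nat \<Rightarrow> nat \<Rightarrow> (nat \<Rightarrow> real) set \<Rightarrow> ((nat \<Rightarrow> real) \<Rightarrow> nat \<Rightarrow> real) \<Rightarrow> bool" where
  "smooth_map_on m n S F \<longleftrightarrow> (\<forall>i<n. \<forall>k. C_k_on m k S (\<lambda>x. F x i))"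

type_synonym 'g chart = "'g set \<times> ('g \<Rightarrow> nat \<Rightarrow> real)"

definition is_chart :: "'g topology \<Rightarrow> nat \<Rightarrow> 'g set \<Rightarrow> ('g \<Rightarrow> nat \<Rightarrow> real) \<Rightarrow> bool" where
  "is_chart X n U \<phi> \<longleftrightarrow>
     openin X U \<and> openin (Euclidean_space n) (\<phi> ` U) \<and>
     homeomorphic_map (subtopology X U) (subtopology (Euclidean_space n) (\<phi> ` U)) \<phi>"

definition smooth_atlas :: "'g topology \<Rightarrow> nat \<Rightarrow> 'g chart set \<Rightarrow> bool" where
  "smooth_atlas X n \<A> \<longleftrightarrow>
     (\<forall>(U, \<phi>)\<in>\<A>. is_chart X n U \<phi>) \<and>
     (\<Union>(U, \<phi>)\<in>\<A>. U) = topspace X \<and>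
     (\<forall>(U, \<phi>)\<in>\<A>. \<forall>(V, \<psi>)\<in>\<A>.
        smooth_map_on n n (\<phi> ` (U \<inter> V)) (\<lambda>x. \<psi> (inv_into U \<phi> x)))"

definition topological_group :: "'g monoid \<Rightarrow> 'g topology \<Rightarrow> bool" where
  "topological_group G X \<longleftrightarrow>
     Group.group G \<and> topspace X = carrier G \<and>
     continuous_map (prod_topology X X) X (\<lambda>(x, y). x \<otimes>\<^bsub>G\<^esub> y) \<and>
     continuous_map X X (\<lambda>x. inv\<^bsub>G\<^esub> x)"

text \<open>The two halves of a point of \<open>R^(n+n)\<close>, which serves as the model of \<open>R^n \<times> R^n\<close>.\<close>

definition left_half :: "nat \<Rightarrow> (nat \<Rightarrow> real) \<Rightarrow> nat \<Rightarrow> real" where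
  "left_half n z = (\<lambda>i. if i < n then z i else 0)"

definition right_half :: "nat \<Rightarrow> (nat \<Rightarrow> real) \<Rightarrow> nat \<Rightarrow> real" where
  "right_half n z = (\<lambda>i. if i < n then z (n + i) else 0)"

definition lie_group :: "'g monoid \<Rightarrow> 'g topology \<Rightarrow> nat \<Rightarrow> 'g chart set \<Rightarrow> bool" where
  "lie_group G X n \<A> \<longleftrightarrow>
     topological_group G X \<and> Hausdorff_space X \<and> second_countable X \<and> smooth_atlas X n \<A> \<and>
     (\<forall>(U, \<phi>)\<in>\<A>. \<forall>(V, \<psi>)\<in>\<A>. \<forall>(W, \<chi>)\<in>\<A>.
        (let p = (\<lambda>z. inv_into U \<phi> (left_half n z) \<otimes>\<^bsub>G\<^esub> inv_into V \<psi> (right_half n z)) in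
         smooth_map_on (n + n) n
           {z \<in> topspace (Euclidean_space (n + n)).
              left_half n z \<in> \<phi> ` U \<and> right_half n z \<in> \<psi> ` V \<and> p z \<in> W}
           (\<lambda>z. \<chi> (p z)))) \<and>
     (\<forall>(U, \<phi>)\<in>\<A>. \<forall>(V, \<psi>)\<in>\<A>.
        smooth_map_on n n (\<phi> ` {x\<in>U. inv\<^bsub>G\<^esub> x \<in> V}) (\<lambda>x. \<psi> (inv\<^bsub>G\<^esub> (inv_into U \<phi> x))))"


section \<open>Maximal tori, the Lie algebra of a torus and its dual\<close>

text \<open>
  A torus is a subgroup isomorphic, as a topological group, to a power of the circle group.
  It is compact, hence closed, so that continuous isomorphisms are automatically smooth.
\<close>

definition torus_in :: "'g monoid \<Rightarrow> 'g topology \<Rightarrow> 'g set \<Rightarrow> bool" where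
  "torus_in G X T \<longleftrightarrow>
     subgroup T G \<and>
     (\<exists>(r::nat) f.
        homeomorphic_map
          (product_topology (\<lambda>_. top_of_set (sphere (0::complex) 1)) {..<r}) (subtopology X T) f \<and>
        (\<forall>x\<in>{..<r} \<rightarrow>\<^sub>E sphere 0 1. \<forall>y\<in>{..<r} \<rightarrow>\<^sub>E sphere 0 1.
           f (\<lambda>i\<in>{..<r}. x i * y i) = f x \<otimes>\<^bsub>G\<^esub> f y))"

definition maximal_torus :: "'g monoid \<Rightarrow> 'g topology \<Rightarrow> 'g set \<Rightarrow> bool" where
  "maximal_torus G X T \<longleftrightarrow>
     torus_in G X T \<and> (\<forall>S. torus_in G X S \<and> T \<subseteq> S \<longrightarrow> S = T)"

text \<open>
  The Lie algebra of \<open>T\<close> is realised as the set of its one-parameter subgroups: \<open>H\<close> corresponds to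
  \<open>s \<mapsto> exp (s H)\<close>. Since \<open>T\<close> is abelian, the vector space operations are
  \<open>(H + K)(s) = H s \<otimes> K s\<close> and \<open>(c H)(s) = H (c s)\<close>, and the exponential map is \<open>H \<mapsto> H 1\<close>.
\<close>

type_synonym 'g ops = "real \<Rightarrow> 'g"

definition lie_alg :: "'g monoid \<Rightarrow> 'g topology \<Rightarrow> 'g set \<Rightarrow> 'g ops set" where
  "lie_alg G X T =
     {H. continuous_map euclideanreal (subtopology X T) H \<and> (\<forall>s t. H (s + t) = H s \<otimes>\<^bsub>G\<^esub> H t)}"

definition lie_add :: "'g monoid \<Rightarrow> 'g ops \<Rightarrow> 'g ops \<Rightarrow> 'g ops" where
  "lie_add G H K = (\<lambda>s. H s \<otimes>\<^bsub>G\<^esub> K s)"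

definition lie_scale :: "real \<Rightarrow> 'g ops \<Rightarrow> 'g ops" where
  "lie_scale c H = (\<lambda>s. H (c * s))"

definition lie_exp :: "'g ops \<Rightarrow> 'g" where
  "lie_exp H = H 1"

definition integral_lattice :: "'g monoid \<Rightarrow> 'g topology \<Rightarrow> 'g set \<Rightarrow> 'g ops set" where
  "integral_lattice G X T = {H \<in> lie_alg G X T. lie_exp H = \<one>\<^bsub>G\<^esub>}"

text \<open>
  The dual space: linear forms on \<^const>\<open>lie_alg\<close>, set to 0 elsewhere so that each form is a
  unique HOL function and sums and multiples can be taken pointwise. Its topology is the one
  inherited from the function type, i.e. pointwise convergence, which on the dual of a
  finite-dimensional space is the usual topology.
\<close>

definition lie_dual :: "'g monoid \<Rightarrow> 'g topology \<Rightarrow> 'g set \<Rightarrow> ('g ops \<Rightarrow> real) set" where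
  "lie_dual G X T =
     {\<mu>. (\<forall>H. H \<notin> lie_alg G X T \<longrightarrow> \<mu> H = 0) \<and>
         (\<forall>H\<in>lie_alg G X T. \<forall>K\<in>lie_alg G X T. \<mu> (lie_add G H K) = \<mu> H + \<mu> K) \<and>
         (\<forall>c. \<forall>H\<in>lie_alg G X T. \<mu> (lie_scale c H) = c * \<mu> H)}"

definition weight_lattice :: "'g monoid \<Rightarrow> 'g topology \<Rightarrow> 'g set \<Rightarrow> ('g ops \<Rightarrow> real) set" where
  "weight_lattice G X T = {\<mu> \<in> lie_dual G X T. \<forall>H\<in>integral_lattice G X T. \<mu> H \<in> \<int>}"

definition form_add :: "('h \<Rightarrow> real) \<Rightarrow> ('h \<Rightarrow> real) \<Rightarrow> 'h \<Rightarrow> real" where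
  "form_add \<mu> \<nu> = (\<lambda>H. \<mu> H + \<nu> H)"

definition form_scale :: "real \<Rightarrow> ('h \<Rightarrow> real) \<Rightarrow> 'h \<Rightarrow> real" where
  "form_scale c \<mu> = (\<lambda>H. c * \<mu> H)"

definition form_hull :: "('h \<Rightarrow> real) set \<Rightarrow> ('h \<Rightarrow> real) set" where
  "form_hull S =
     {(\<lambda>H. \<Sum>\<mu>\<in>F. c \<mu> * \<mu> H) | F c.
        finite F \<and> F \<subseteq> S \<and> (\<forall>\<mu>\<in>F. 0 \<le> c \<mu>) \<and> (\<Sum>\<mu>\<in>F. c \<mu>) = (1::real)}"


section \<open>The Weyl group action\<close>

text \<open>
  \<open>g \<in> N(T)\<close> acts on forms by \<open>(g \<cdot> \<mu>)(H) = \<mu> (Ad(g\<inverse>) H)\<close>. As \<open>T\<close> acts trivially, this is the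
  action of the Weyl group \<open>W = N(T)/T\<close>, and \<open>W\<close>-orbits and \<open>W\<close>-invariance are those of \<open>N(T)\<close>.
\<close>

definition coadjoint ::
    "'g monoid \<Rightarrow> 'g topology \<Rightarrow> 'g set \<Rightarrow> 'g \<Rightarrow> ('g ops \<Rightarrow> real) \<Rightarrow> 'g ops \<Rightarrow> real" where
  "coadjoint G X T g \<mu> =
     (\<lambda>H. if H \<in> lie_alg G X T then \<mu> (\<lambda>s. inv\<^bsub>G\<^esub> g \<otimes>\<^bsub>G\<^esub> H s \<otimes>\<^bsub>G\<^esub> g) else 0)"

definition weyl_orbit ::
    "'g monoid \<Rightarrow> 'g topology \<Rightarrow> 'g set \<Rightarrow> ('g ops \<Rightarrow> real) \<Rightarrow> ('g ops \<Rightarrow> real) set" where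
  "weyl_orbit G X T \<mu> = (\<lambda>g. coadjoint G X T g \<mu>) ` normalizer G T"

definition weight_polytope ::
    "'g monoid \<Rightarrow> 'g topology \<Rightarrow> 'g set \<Rightarrow> ('g ops \<Rightarrow> real) \<Rightarrow> ('g ops \<Rightarrow> real) set" where
  "weight_polytope G X T \<mu> = form_hull (weyl_orbit G X T \<mu>)"


section \<open>Representations and weight multiplicities\<close>

definition is_rep :: "'g monoid \<Rightarrow> 'g topology \<Rightarrow> nat \<Rightarrow> ('g \<Rightarrow> complex Matrix.mat) \<Rightarrow> bool" where
  "is_rep G X d \<rho> \<longleftrightarrow>
     (\<forall>g\<in>carrier G. \<rho> g \<in> carrier_mat d d) \<and>
     \<rho> \<one>\<^bsub>G\<^esub> = 1\<^sub>m d \<and>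
     (\<forall>g\<in>carrier G. \<forall>h\<in>carrier G. \<rho> (g \<otimes>\<^bsub>G\<^esub> h) = \<rho> g * \<rho> h) \<and>
     (\<forall>i<d. \<forall>j<d. continuous_map X euclidean (\<lambda>g. \<rho> g $$ (i, j)))"

definition irreducible_rep ::
    "'g monoid \<Rightarrow> 'g topology \<Rightarrow> nat \<Rightarrow> ('g \<Rightarrow> complex Matrix.mat) \<Rightarrow> bool" where
  "irreducible_rep G X d \<rho> \<longleftrightarrow>
     is_rep G X d \<rho> \<and> d > 0 \<and>
     (\<forall>U. VectorSpace.subspace class_ring U (module_vec TYPE(complex) d) \<and>
          (\<forall>g\<in>carrier G. \<forall>v\<in>U. \<rho> g *\<^sub>v v \<in> U)
          \<longrightarrow> U = {0\<^sub>v d} \<or> U = carrier_vec d)"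

definition weight_space ::
    "'g monoid \<Rightarrow> 'g topology \<Rightarrow> 'g set \<Rightarrow> nat \<Rightarrow> ('g \<Rightarrow> complex Matrix.mat) \<Rightarrow> ('g ops \<Rightarrow> real)
       \<Rightarrow> complex Matrix.vec set" where
  "weight_space G X T d \<rho> \<nu> =
     {v \<in> carrier_vec d.
        \<forall>H\<in>lie_alg G X T. \<rho> (lie_exp H) *\<^sub>v v = exp (2 * pi * \<i> * \<nu> H) \<cdot>\<^sub>v v}"

definition weight_mult ::
    "'g monoid \<Rightarrow> 'g topology \<Rightarrow> 'g set \<Rightarrow> nat \<Rightarrow> ('g \<Rightarrow> complex Matrix.mat) \<Rightarrow> ('g ops \<Rightarrow> real)
       \<Rightarrow> nat" where
  "weight_mult G X T d \<rho> \<nu> =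
     vectorspace.dim class_ring
       (module_vec TYPE(complex) d \<lparr>carrier := weight_space G X T d \<rho> \<nu>\<rparr>)"

definition weights ::
    "'g monoid \<Rightarrow> 'g topology \<Rightarrow> 'g set \<Rightarrow> nat \<Rightarrow> ('g \<Rightarrow> complex Matrix.mat)
       \<Rightarrow> ('g ops \<Rightarrow> real) set" where
  "weights G X T d \<rho> = {\<mu> \<in> weight_lattice G X T. weight_mult G X T d \<rho> \<mu> \<noteq> 0}"

text \<open>
  The matrix of a tensor product of operators, in the lexicographically ordered product basis, is
  the Kronecker product of their matrices.
\<close>

definition kronecker :: "complex Matrix.mat \<Rightarrow> complex Matrix.mat \<Rightarrow> complex Matrix.mat" where
  "kronecker A B =
     Matrix.mat (dim_row A * dim_row B) (dim_col A * dim_col B)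
       (\<lambda>(i, j). A $$ (i div dim_row B, j div dim_col B) * B $$ (i mod dim_row B, j mod dim_col B))"

primrec tensor_power :: "('g \<Rightarrow> complex Matrix.mat) \<Rightarrow> nat \<Rightarrow> 'g \<Rightarrow> complex Matrix.mat" where
  "tensor_power \<rho> 0 g = 1\<^sub>m 1"
| "tensor_power \<rho> (Suc N) g = kronecker (\<rho> g) (tensor_power \<rho> N g)"


section \<open>Roots, Weyl chambers and highest weights\<close>

text \<open>
  The matrix of \<open>Ad(g)\<close> on the tangent space at the identity, in the basis given by a chart
  \<open>(U, \<phi>)\<close> around the identity: the Jacobian of \<open>x \<mapsto> g x g\<inverse>\<close> there. Its entries are taken in
  the complex numbers, i.e. this is the action on the complexified Lie algebra.
\<close>

definition Ad_mat ::
    "'g monoid \<Rightarrow> nat \<Rightarrow> 'g set \<Rightarrow> ('g \<Rightarrow> nat \<Rightarrow> real) \<Rightarrow> 'g \<Rightarrow> complex Matrix.mat" where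
  "Ad_mat G n U \<phi> g =
     Matrix.mat n n
       (\<lambda>(i, j). complex_of_real
          (partial_deriv j (\<lambda>x. \<phi> (g \<otimes>\<^bsub>G\<^esub> inv_into U \<phi> x \<otimes>\<^bsub>G\<^esub> inv\<^bsub>G\<^esub> g) i) (\<phi> \<one>\<^bsub>G\<^esub>)))"

text \<open>
  Roots are the nonzero weights of the adjoint representation. Another chart conjugates
  \<^const>\<open>Ad_mat\<close> by a constant matrix, so the choice of the chart is immaterial.
\<close>

definition roots ::
    "'g monoid \<Rightarrow> 'g topology \<Rightarrow> nat \<Rightarrow> 'g chart set \<Rightarrow> 'g set \<Rightarrow> ('g ops \<Rightarrow> real) set" where
  "roots G X n \<A> T =
     {\<alpha>. \<alpha> \<noteq> (\<lambda>_. 0) \<and> (\<exists>(U, \<phi>)\<in>\<A>. \<one>\<^bsub>G\<^esub> \<in> U \<and> \<alpha> \<in> weights G X T n (Ad_mat G n U \<phi>))}"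

definition weyl_inner ::
    "'g monoid \<Rightarrow> 'g topology \<Rightarrow> 'g set \<Rightarrow> (('g ops \<Rightarrow> real) \<Rightarrow> ('g ops \<Rightarrow> real) \<Rightarrow> real) \<Rightarrow> bool" where
  "weyl_inner G X T B \<longleftrightarrow>
     (\<forall>\<mu>\<in>lie_dual G X T. \<forall>\<nu>\<in>lie_dual G X T.
        B \<mu> \<nu> = B \<nu> \<mu> \<and>
        (\<forall>\<kappa>\<in>lie_dual G X T. B (form_add \<mu> \<nu>) \<kappa> = B \<mu> \<kappa> + B \<nu> \<kappa>) \<and>
        (\<forall>c. B (form_scale c \<mu>) \<nu> = c * B \<mu> \<nu>) \<and>
        (\<forall>g\<in>normalizer G T. B (coadjoint G X T g \<mu>) (coadjoint G X T g \<nu>) = B \<mu> \<nu>)) \<and>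
     (\<forall>\<mu>\<in>lie_dual G X T. \<mu> \<noteq> (\<lambda>_. 0) \<longrightarrow> B \<mu> \<mu> > 0)"

text \<open>
  Open Weyl chambers: connected components of the complement of the root hyperplanes. The
  hyperplanes do not depend on the \<open>W\<close>-invariant inner product.
\<close>

definition weyl_chamber ::
    "'g monoid \<Rightarrow> 'g topology \<Rightarrow> nat \<Rightarrow> 'g chart set \<Rightarrow> 'g set \<Rightarrow> ('g ops \<Rightarrow> real) set \<Rightarrow> bool" where
  "weyl_chamber G X n \<A> T C \<longleftrightarrow>
     (\<exists>B. weyl_inner G X T B \<and>
          C \<in> components (lie_dual G X T - (\<Union>\<alpha>\<in>roots G X n \<A> T. {\<mu>. B \<mu> \<alpha> = 0})))"

definition dominant_weights ::
    "'g monoid \<Rightarrow> 'g topology \<Rightarrow> 'g set \<Rightarrow> ('g ops \<Rightarrow> real) set \<Rightarrow> ('g ops \<Rightarrow> real) set" where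
  "dominant_weights G X T C = weight_lattice G X T \<inter> closure C"

text \<open>
  The partial order on weights of a compact Lie group, as in the textbooks of Adams and of
  Broecker and tom Dieck: \<open>\<mu> \<le> \<nu>\<close> iff the convex hull of \<open>W\<mu>\<close> is contained in that of \<open>W\<nu>\<close>.
  The highest weight of a representation is its dominant weight that is above all its weights.
\<close>

definition weight_le ::
    "'g monoid \<Rightarrow> 'g topology \<Rightarrow> 'g set \<Rightarrow> ('g ops \<Rightarrow> real) \<Rightarrow> ('g ops \<Rightarrow> real) \<Rightarrow> bool" where
  "weight_le G X T \<mu> \<nu> \<longleftrightarrow> weight_polytope G X T \<mu> \<subseteq> weight_polytope G X T \<nu>"

definition is_highest_weight ::
    "'g monoid \<Rightarrow> 'g topology \<Rightarrow> 'g set \<Rightarrow> ('g ops \<Rightarrow> real) set \<Rightarrow> nat \<Rightarrow> ('g \<Rightarrow> complex Matrix.mat)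
       \<Rightarrow> ('g ops \<Rightarrow> real) \<Rightarrow> bool" where
  "is_highest_weight G X T C d \<rho> \<nu> \<longleftrightarrow>
     \<nu> \<in> dominant_weights G X T C \<and> \<nu> \<in> weights G X T d \<rho> \<and>
     (\<forall>\<mu>\<in>weights G X T d \<rho>. weight_le G X T \<mu> \<nu>)"


section \<open>The measures and their limit\<close>

definition dual_borel :: "'g monoid \<Rightarrow> 'g topology \<Rightarrow> 'g set \<Rightarrow> ('g ops \<Rightarrow> real) measure" where
  "dual_borel G X T = restrict_space borel (lie_dual G X T)"

text \<open>
  The weighted sum of Dirac measures at the points \<open>\<nu>/N\<close>, written as the image under
  \<open>\<nu> \<mapsto> \<nu>/N\<close> of the measure giving each \<open>\<nu>\<close> its weight.
\<close>

definition weight_measure ::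
    "'g monoid \<Rightarrow> 'g topology \<Rightarrow> 'g set \<Rightarrow> nat \<Rightarrow> ('g \<Rightarrow> complex Matrix.mat) \<Rightarrow> ('g ops \<Rightarrow> real) \<Rightarrow> nat
       \<Rightarrow> ('g ops \<Rightarrow> real) measure" where
  "weight_measure G X T d \<rho> \<mu> N =
     distr
       (point_measure (weight_polytope G X T (form_scale (real N) \<mu>) \<inter> weight_lattice G X T)
         (\<lambda>\<nu>. ennreal (real (weight_mult G X T (d ^ N) (tensor_power \<rho> N) \<nu>) / real d ^ N)))
       (dual_borel G X T)
       (form_scale (1 / real N))"

definition mean_weight ::
    "'g monoid \<Rightarrow> 'g topology \<Rightarrow> 'g set \<Rightarrow> nat \<Rightarrow> ('g \<Rightarrow> complex Matrix.mat) \<Rightarrow> 'g ops \<Rightarrow> real" where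
  "mean_weight G X T d \<rho> =
     (\<lambda>H. 1 / real d * (\<Sum>\<nu>\<in>weights G X T d \<rho>. real (weight_mult G X T d \<rho> \<nu>) * \<nu> H))"

definition weakly_converges_on ::
    "'a::topological_space set \<Rightarrow> (nat \<Rightarrow> 'a measure) \<Rightarrow> 'a measure \<Rightarrow> bool" where
  "weakly_converges_on S M L \<longleftrightarrow>
     (\<forall>f :: 'a \<Rightarrow> real. continuous_on S f \<and> bounded (f ` S) \<longrightarrow>
        (\<lambda>N. integral\<^sup>L (M N) f) \<longlonglongrightarrow> integral\<^sup>L L f)"

end

theory Submission
  imports Defs "Jordan_Normal_Form.DL_Rank" "Jordan_Normal_Form.Schur_Decomposition"
begin

text \<open>
  Restricted to the maximal torus, the representation is a sum of \<open>d\<close> lines with weights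
  \<open>w 0, \<dots>, w (d - 1)\<close>. Its \<open>N\<close>-th tensor power is then a sum of \<open>d^N\<close> lines, one for each choice of \<open>N\<close> of these
  lines, and its weights are the sums of \<open>N\<close> of the \<open>w i\<close>. Choosing one of the \<open>d^N\<close> lines uniformly amounts
  to choosing \<open>N\<close> of the \<open>w i\<close> independently and uniformly, so the measure in question is the law of the
  average of \<open>N\<close> independent random weights with mean \<open>Q*(\<lambda>)\<close>, and the theorem is the weak law of large
  numbers. No weight of the tensor power is lost by restricting to the polytope of \<open>N \<lambda>\<close>: every \<open>w i\<close> is
  below the highest weight and so lies in the convex hull of the orbit of \<open>\<lambda>\<close>, and a sum of \<open>N\<close> points of a
  convex set lies in its \<open>N\<close>-fold dilation (\<open>tensor_weight_in_hull\<close>). Hence the total mass is 1.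

  The decomposition into weight lines (\<open>torus_rep_weights\<close>) rests on compactness in the form of
  boundedness alone. In a bounded group of matrices a generalised eigenvector is an eigenvector, since
  a Jordan block has unbounded powers (\<open>bounded_mat_group_semisimple\<close>). Commuting matrices with this
  property have a common eigenbasis (\<open>commuting_semisimple_diagonalizable\<close>), and the eigenvalues along
  a one-parameter subgroup form a continuous character of the real line
  (\<open>unitary_character_real\<close>). Once a representation is in diagonal form, the multiplicity of a weight is
  the number of its occurrences on the diagonal (\<open>weight_mult_diagonal\<close>); the Kronecker product carries
  diagonal forms to diagonal forms.

  In the topology of pointwise convergence on the dual space a neighbourhood is cut out by finitely
  many coordinates, so convergence follows from Chebyshev's inequality for each coordinate
  (\<open>tensor_weight_law_of_large_numbers\<close>).
\<close>

section \<open>Sums of eigenvectors\<close>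

abbreviation vec_subspace :: "nat \<Rightarrow> complex Matrix.vec set \<Rightarrow> bool" where
  "vec_subspace d U \<equiv> VectorSpace.subspace class_ring U (module_vec TYPE(complex) d)"

lemma vec_subspaceI:
  assumes "U \<subseteq> carrier_vec d" and "0\<^sub>v d \<in> U"
    and "\<And>v w. v \<in> U \<Longrightarrow> w \<in> U \<Longrightarrow> v + w \<in> U"
    and "\<And>c v. v \<in> U \<Longrightarrow> c \<cdot>\<^sub>v v \<in> U"
  shows "vec_subspace d U"
proof -
  interpret V: vec_space "TYPE(complex)" d .
  show ?thesis
    unfolding subspace_def submodule_def
    using assms V.vectorspace_axioms V.module_axioms by (auto simp: module_vec_simps)
qed

lemma vec_subspaceD:
  assumes "vec_subspace d U"
  shows "U \<subseteq> carrier_vec d" and "0\<^sub>v d \<in> U"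
    and "\<And>v w. v \<in> U \<Longrightarrow> w \<in> U \<Longrightarrow> v + w \<in> U"
    and "\<And>c v. v \<in> U \<Longrightarrow> c \<cdot>\<^sub>v v \<in> U"
    and "\<And>v w. v \<in> U \<Longrightarrow> w \<in> U \<Longrightarrow> v - w \<in> U"
proof -
  interpret V: vec_space "TYPE(complex)" d .
  have s: "submodule class_ring U (module_vec TYPE(complex) d)"
    using assms unfolding subspace_def by blast
  show sub: "U \<subseteq> carrier_vec d" using submodule.subset[OF s] by simp
  show "0\<^sub>v d \<in> U" using submodule.zero_closed[OF s] by simp
  show add: "v + w \<in> U" if "v \<in> U" "w \<in> U" for v w
    using submodule.m_closed[OF s that] by simp
  show smult: "c \<cdot>\<^sub>v v \<in> U" if "v \<in> U" for c v
    using submodule.smult_closed[OF s _ that] by (simp add: class_ring_simps)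
  show "v - w \<in> U" if "v \<in> U" "w \<in> U" for v w
  proof -
    have "v - w = v + (-1) \<cdot>\<^sub>v w"
      using that sub by (intro eq_vecI) auto
    then show ?thesis using add[OF that(1) smult[OF that(2)]] by simp
  qed
qed

text \<open>
  For a set \<open>E\<close> of eigenvectors, which is closed under scaling, the finite sums of members of \<open>E\<close>
  are the span of \<open>E\<close>. Generating them one summand at a time turns a decomposition into
  eigenvectors into an induction without coefficients.
\<close>

inductive_set vec_sums :: "nat \<Rightarrow> complex Matrix.vec set \<Rightarrow> complex Matrix.vec set" for d E where
  vec_sums_zero: "0\<^sub>v d \<in> vec_sums d E"
| vec_sums_step: "v \<in> vec_sums d E \<Longrightarrow> w \<in> E \<Longrightarrow> v + w \<in> vec_sums d E"

lemma vec_sums_carrier: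
  assumes "E \<subseteq> carrier_vec d" "v \<in> vec_sums d E"
  shows "v \<in> carrier_vec d"
  using assms(2,1) by induction auto

lemma vec_sums_subset:
  assumes "vec_subspace d U" "E \<subseteq> U" "v \<in> vec_sums d E"
  shows "v \<in> U"
  using assms(3) by induction (use vec_subspaceD[OF assms(1)] assms(2) in auto)

lemma vec_sums_gen:
  assumes "E \<subseteq> carrier_vec d" "w \<in> E"
  shows "w \<in> vec_sums d E"
proof -
  have "0\<^sub>v d + w \<in> vec_sums d E" using assms by (intro vec_sums.intros)
  then show ?thesis using assms by auto
qed

lemma vec_sums_add:
  assumes "E \<subseteq> carrier_vec d" "w \<in> vec_sums d E" "v \<in> vec_sums d E"
  shows "v + w \<in> vec_sums d E"
  using assms(2)
proof induction
  case vec_sums_zero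
  then show ?case using assms vec_sums_carrier by auto
next
  case (vec_sums_step a b)
  have "v + (a + b) = (v + a) + b"
    using vec_sums_carrier[OF assms(1) assms(3)] vec_sums_carrier[OF assms(1) vec_sums_step(1)]
      vec_sums_step assms(1) by (intro assoc_add_vec[symmetric]) auto
  then show ?case using vec_sums.intros(2)[OF vec_sums_step(3,2)] by simp
qed

lemma vec_sums_trans:
  assumes "E \<subseteq> carrier_vec d" "E' \<subseteq> vec_sums d E" "v \<in> vec_sums d E'"
  shows "v \<in> vec_sums d E"
  using assms(3)
proof induction
  case vec_sums_zero
  then show ?case by (rule vec_sums.vec_sums_zero)
next
  case (vec_sums_step a b)
  then show ?case using vec_sums_add[OF assms(1)] assms(2) by blast
qed

definition shift_op :: "complex Matrix.mat \<Rightarrow> complex \<Rightarrow> complex Matrix.vec \<Rightarrow> complex Matrix.vec" where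
  "shift_op A c v = A *\<^sub>v v - c \<cdot>\<^sub>v v"

lemma shift_op_carrier [simp]:
  "A \<in> carrier_mat d d \<Longrightarrow> v \<in> carrier_vec d \<Longrightarrow> shift_op A c v \<in> carrier_vec d"
  by (simp add: shift_op_def)

lemma shift_op_diff:
  assumes "A \<in> carrier_mat d d" "v \<in> carrier_vec d" "w \<in> carrier_vec d"
  shows "shift_op A c (v - w) = shift_op A c v - shift_op A c w"
  using assms unfolding shift_op_def
  by (intro eq_vecI) (auto simp: mult_minus_distrib_mat_vec algebra_simps)

lemma shift_op_eigen_iff:
  assumes "A \<in> carrier_mat d d" "v \<in> carrier_vec d"
  shows "shift_op A c v = 0\<^sub>v d \<longleftrightarrow> A *\<^sub>v v = c \<cdot>\<^sub>v v"
proof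
  assume *: "shift_op A c v = 0\<^sub>v d"
  show "A *\<^sub>v v = c \<cdot>\<^sub>v v"
  proof (intro eq_vecI)
    fix i assume "i < dim_vec (c \<cdot>\<^sub>v v)"
    then have "shift_op A c v $ i = 0" "i < d" using * assms by auto
    then show "(A *\<^sub>v v) $ i = (c \<cdot>\<^sub>v v) $ i" using assms by (auto simp: shift_op_def)
  qed (use assms in auto)
next
  assume "A *\<^sub>v v = c \<cdot>\<^sub>v v"
  then show "shift_op A c v = 0\<^sub>v d"
    using assms by (auto simp: shift_op_def)
qed

text \<open>
  Generalised eigenvectors are eigenvectors. Over the complex numbers this means diagonalizable, and
  in this form it can be read off from a growth estimate, see \<open>bounded_mat_group_semisimple\<close>.
\<close>

definition semisimple_mat :: "nat \<Rightarrow> complex Matrix.mat \<Rightarrow> bool" where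
  "semisimple_mat d A \<longleftrightarrow> A \<in> carrier_mat d d \<and>
     (\<forall>c. \<forall>v\<in>carrier_vec d. shift_op A c (shift_op A c v) = 0\<^sub>v d \<longrightarrow> shift_op A c v = 0\<^sub>v d)"

text \<open>
  Write \<open>(A - c) v\<close> as a sum of eigenvectors. On an eigenvector whose eigenvalue \<open>c'\<close> differs from
  \<open>c\<close> the operator \<open>A - c\<close> is multiplication by \<open>c' - c\<close>, so these summands have a preimage \<open>t\<close> that is
  again a sum of eigenvectors. What is left, \<open>(A - c) (v - t)\<close>, is killed by \<open>A - c\<close>; hence \<open>v - t\<close> is
  a generalised eigenvector, and semisimplicity makes it an eigenvector.
\<close>

lemma eigen_sum_step:
  assumes A: "semisimple_mat d A" and U: "vec_subspace d U"
    and v: "v \<in> U" and inv: "\<And>u. u \<in> U \<Longrightarrow> A *\<^sub>v u \<in> U"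
    and E: "E = {w\<in>U. \<exists>c. A *\<^sub>v w = c \<cdot>\<^sub>v w}"
    and s: "shift_op A c v \<in> vec_sums d E"
  shows "v \<in> vec_sums d E"
proof -
  note D = vec_subspaceD[OF U]
  have Ac: "A \<in> carrier_mat d d" using A by (simp add: semisimple_mat_def)
  have EU: "E \<subseteq> U" and Ecar: "E \<subseteq> carrier_vec d" using E D(1) by auto
  have split: "\<exists>t\<in>vec_sums d E. \<exists>z\<in>U. A *\<^sub>v z = c \<cdot>\<^sub>v z \<and> s = shift_op A c t + z"
    if "s \<in> vec_sums d E" for s
    using that
  proof induction
    case vec_sums_zero
    have "A *\<^sub>v 0\<^sub>v d = c \<cdot>\<^sub>v 0\<^sub>v d" using Ac by (auto intro!: eq_vecI)
    moreover have "0\<^sub>v d = shift_op A c (0\<^sub>v d) + 0\<^sub>v d"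
      using Ac by (auto simp: shift_op_def intro!: eq_vecI)
    ultimately show ?case using vec_sums.vec_sums_zero D(2) by blast
  next
    case (vec_sums_step s w)
    then obtain t z where t: "t \<in> vec_sums d E" and z: "z \<in> U" "A *\<^sub>v z = c \<cdot>\<^sub>v z"
      and s: "s = shift_op A c t + z" by blast
    obtain c' where w: "w \<in> U" "A *\<^sub>v w = c' \<cdot>\<^sub>v w" using vec_sums_step(2) E by blast
    have tc: "t \<in> carrier_vec d" using t vec_sums_carrier[OF Ecar] by blast
    have zc: "z \<in> carrier_vec d" "w \<in> carrier_vec d" using z w D(1) by auto
    show ?case
    proof (cases "c' = c")
      case True
      have "A *\<^sub>v (z + w) = c \<cdot>\<^sub>v (z + w)"
        using z w True Ac zc by (simp add: mult_add_distrib_mat_vec smult_add_distrib_vec)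
      moreover have "s + w = shift_op A c t + (z + w)"
        unfolding s using Ac tc zc by (intro assoc_add_vec) auto
      ultimately show ?thesis using t D(3)[OF z(1) w(1)] by blast
    next
      case False
      define w' where "w' = (1 / (c' - c)) \<cdot>\<^sub>v w"
      have w'U: "w' \<in> U" unfolding w'_def using D(4) w by blast
      have w'c: "w' \<in> carrier_vec d" using w'U D(1) by auto
      have "A *\<^sub>v w' = c' \<cdot>\<^sub>v w'"
        unfolding w'_def using Ac zc w(2) by (auto simp: mult_mat_vec intro!: eq_vecI)
      then have "w' \<in> E" and Aw': "A *\<^sub>v w' = c' \<cdot>\<^sub>v w'" using w'U E by auto
      then have "t + w' \<in> vec_sums d E" using t by (intro vec_sums.intros)
      moreover have "shift_op A c w' = w"
      proof (rule eq_vecI)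
        fix i assume i: "i < dim_vec w"
        have "shift_op A c w' $ i = c' * (w $ i / (c' - c)) - c * (w $ i / (c' - c))"
          unfolding shift_op_def Aw' using i zc w'c by (auto simp: w'_def)
        also have "\<dots> = (c' - c) * (w $ i / (c' - c))" by (rule left_diff_distrib[symmetric])
        also have "\<dots> = w $ i" using False by simp
        finally show "shift_op A c w' $ i = w $ i" .
      qed (use zc w'c in \<open>auto simp: shift_op_def\<close>)
      then have "s + w = shift_op A c (t + w') + z"
        unfolding s using Ac tc zc w'c
        by (auto simp: shift_op_def mult_add_distrib_mat_vec algebra_simps intro!: eq_vecI)
      ultimately show ?thesis using z by blast
    qed
  qed
  obtain t z where t: "t \<in> vec_sums d E" and z: "z \<in> U" "A *\<^sub>v z = c \<cdot>\<^sub>v z"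
    and s': "shift_op A c v = shift_op A c t + z" using split[OF s] by blast
  have tU: "t \<in> U" using vec_sums_subset[OF U EU t] .
  have car: "t \<in> carrier_vec d" "v \<in> carrier_vec d" "z \<in> carrier_vec d"
    using tU v z D(1) by auto
  have "shift_op A c (v - t) = shift_op A c v - shift_op A c t"
    using shift_op_diff[OF Ac car(2,1)] .
  also have "\<dots> = z"
    unfolding s' using car shift_op_carrier[OF Ac car(1), of c] by (auto intro!: eq_vecI)
  finally have z': "shift_op A c (v - t) = z" .
  then have "shift_op A c (shift_op A c (v - t)) = 0\<^sub>v d"
    using shift_op_eigen_iff[OF Ac car(3)] z by simp
  then have "shift_op A c (v - t) = 0\<^sub>v d"
    using A car unfolding semisimple_mat_def by auto
  then have "A *\<^sub>v (v - t) = c \<cdot>\<^sub>v (v - t)"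
    using shift_op_eigen_iff[OF Ac] car by auto
  then have "v - t \<in> E" using D(5)[OF v tU] E by blast
  then have "t + (v - t) \<in> vec_sums d E" using t by (intro vec_sums.intros)
  moreover have "t + (v - t) = v" using car by (auto intro!: eq_vecI)
  ultimately show ?thesis by simp
qed

text \<open>
  A form of the Cayley-Hamilton theorem. If \<open>A\<close> is conjugate to an upper triangular \<open>B\<close>, then
  \<open>A - B_kk\<close> maps the \<open>(k+1)\<close>-st space of the invariant flag into the \<open>k\<close>-th.
\<close>

lemma annihilating_shifts:
  assumes A: "A \<in> carrier_mat d d"
  shows "\<exists>cs. \<forall>v\<in>carrier_vec d. fold (shift_op A) cs v = 0\<^sub>v d"
proof -
  obtain es where "char_poly A = (\<Prod>a\<leftarrow>es. [:- a, 1:])"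
    using char_poly_factorized[OF A] by blast
  then obtain B where B: "B \<in> carrier_mat d d" "upper_triangular B" and sim: "similar_mat A B"
    using schur_decomposition_exists[OF A] by blast
  obtain P Q where "similar_mat_wit A B P Q" using sim unfolding similar_mat_def by blast
  note W = similar_mat_witD2[OF A this]
  have key: "\<exists>cs. \<forall>x\<in>carrier_vec d. (\<forall>j<d. k \<le> j \<longrightarrow> x $ j = 0) \<longrightarrow> fold (shift_op A) cs (P *\<^sub>v x) = 0\<^sub>v d"
    if "k \<le> d" for k
    using that
  proof (induction k)
    case 0
    have "P *\<^sub>v x = 0\<^sub>v d" if "x \<in> carrier_vec d" "\<forall>j<d. 0 \<le> j \<longrightarrow> x $ j = 0" for x
    proof -
      have "x = 0\<^sub>v d" using that by (intro eq_vecI) auto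
      then show ?thesis using W(6) by (auto intro!: eq_vecI)
    qed
    then show ?case by (intro exI[of _ "[]"]) auto
  next
    case (Suc k)
    then obtain cs where cs: "\<And>x. x \<in> carrier_vec d \<Longrightarrow> (\<forall>j<d. k \<le> j \<longrightarrow> x $ j = 0) \<Longrightarrow>
        fold (shift_op A) cs (P *\<^sub>v x) = 0\<^sub>v d" by auto
    have k: "k < d" using Suc by simp
    \<comment> \<open>Only coordinate \<open>k\<close> of \<open>x\<close> can contribute to coordinates from \<open>k\<close> on, and this diagonal entry cancels it.\<close>
    define c where "c = B $$ (k, k)"
    have "fold (shift_op A) (c # cs) (P *\<^sub>v x) = 0\<^sub>v d"
      if x: "x \<in> carrier_vec d" and z: "\<forall>j<d. Suc k \<le> j \<longrightarrow> x $ j = 0" for x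
    proof -
      have "A *\<^sub>v (P *\<^sub>v x) = P *\<^sub>v (B *\<^sub>v x)"
      proof -
        have "A * P = P * B * (Q * P)" unfolding W(3) using W B by (intro assoc_mult_mat) auto
        also have "\<dots> = P * B" using W B by simp
        finally have "A * P = P * B" .
        then show ?thesis using W x by (metis assoc_mult_mat_vec)
      qed
      then have "shift_op A c (P *\<^sub>v x) = P *\<^sub>v shift_op B c x"
        unfolding shift_op_def using W(6) x B(1)
        by (subst mult_minus_distrib_mat_vec[of P d d]) (auto simp: mult_mat_vec)
      moreover have "shift_op B c x $ j = 0" if j: "j < d" "k \<le> j" for j
      proof -
        have "(B *\<^sub>v x) $ j = (\<Sum>i\<in>{0..<d}. B $$ (j, i) * x $ i)"
          using B(1) x j by (auto simp: scalar_prod_def)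
        also have "\<dots> = (\<Sum>i\<in>{k}. B $$ (j, i) * x $ i)"
        proof (rule sum.mono_neutral_right)
          show "\<forall>i\<in>{0..<d} - {k}. B $$ (j, i) * x $ i = 0"
          proof
            fix i assume "i \<in> {0..<d} - {k}"
            then consider "i < k" | "Suc k \<le> i" "i < d" by fastforce
            then show "B $$ (j, i) * x $ i = 0"
            proof cases
              case 1
              then have "B $$ (j, i) = 0" using B j by (intro upper_triangularD) auto
              then show ?thesis by simp
            qed (use z in auto)
          qed
        qed (use k in auto)
        also have "\<dots> = c * x $ j"
        proof (cases "j = k")
          case False
          then have "B $$ (j, k) = 0" using B j by (intro upper_triangularD) auto
          then show ?thesis using False z j by auto
        qed (simp add: c_def)
        finally show ?thesis using B(1) x j by (auto simp: shift_op_def)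
      qed
      ultimately show ?thesis using cs[of "shift_op B c x"] B(1) x by auto
    qed
    then show ?case by blast
  qed
  obtain cs where cs: "\<And>x. x \<in> carrier_vec d \<Longrightarrow> fold (shift_op A) cs (P *\<^sub>v x) = 0\<^sub>v d"
    using key[of d] by auto
  have "fold (shift_op A) cs v = 0\<^sub>v d" if v: "v \<in> carrier_vec d" for v
  proof -
    have "P *\<^sub>v (Q *\<^sub>v v) = v" using W v by (metis assoc_mult_mat_vec one_mult_mat_vec)
    then show ?thesis using cs[of "Q *\<^sub>v v"] W v by auto
  qed
  then show ?thesis by blast
qed

text \<open>
  The decomposition stays inside any invariant subspace, which is what lets it be refined by a
  further commuting operator.
\<close>

lemma semisimple_eigen_sums:
  assumes A: "semisimple_mat d A" and U: "vec_subspace d U"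
    and v: "v \<in> U" and inv: "\<And>u. u \<in> U \<Longrightarrow> A *\<^sub>v u \<in> U"
  shows "v \<in> vec_sums d {w\<in>U. \<exists>c. A *\<^sub>v w = c \<cdot>\<^sub>v w}"
proof -
  have Ac: "A \<in> carrier_mat d d" using A by (simp add: semisimple_mat_def)
  obtain cs where cs: "\<And>v. v \<in> carrier_vec d \<Longrightarrow> fold (shift_op A) cs v = 0\<^sub>v d"
    using annihilating_shifts[OF Ac] by blast
  have "fold (shift_op A) cs v = 0\<^sub>v d" using cs v vec_subspaceD(1)[OF U] by blast
  then show ?thesis using v
  proof (induction cs arbitrary: v)
    case Nil
    then show ?case using vec_sums_zero by simp
  next
    case (Cons c cs)
    have "shift_op A c v \<in> U"
      unfolding shift_op_def using Cons.prems inv vec_subspaceD[OF U] by auto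
    then have "shift_op A c v \<in> vec_sums d {w\<in>U. \<exists>c. A *\<^sub>v w = c \<cdot>\<^sub>v w}"
      using Cons by auto
    then show ?case using eigen_sum_step[OF A U Cons.prems(2) inv refl] by blast
  qed
qed

section \<open>Simultaneous diagonalization\<close>

text \<open>
  The measure is the dimension, realised as the largest size of a linearly independent subset.
  It serves as the termination measure for splitting invariant subspaces.
\<close>

lemma subspace_measure:
  obtains m :: "complex Matrix.vec set \<Rightarrow> nat"
  where "\<And>U W. vec_subspace d U \<Longrightarrow> vec_subspace d W \<Longrightarrow> W \<subset> U \<Longrightarrow> m W < m U"
proof -
  interpret V: vec_space "TYPE(complex)" d .
  define K where "K U = card ` {B. B \<subseteq> U \<and> \<not> V.lin_dep B}" for U
  have fin: "finite (K U)" if "vec_subspace d U" for U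
  proof (rule finite_subset)
    show "K U \<subseteq> {..V.dim}"
      unfolding K_def using V.li_le_dim(2) V.fin_dim vec_subspaceD(1)[OF that] by auto
  qed simp
  have ne: "K U \<noteq> {}" for U
  proof -
    have "\<not> V.lin_dep {}" unfolding V.lin_dep_def by auto
    then show ?thesis unfolding K_def by auto
  qed
  show ?thesis
  proof (rule that[of "\<lambda>U. Max (K U)"])
    fix U W assume U: "vec_subspace d U" and W: "vec_subspace d W" and "W \<subset> U"
    then obtain u where u: "u \<in> U" "u \<notin> W" by blast
    obtain B where B: "B \<subseteq> W" "\<not> V.lin_dep B" and c: "card B = Max (K W)"
      using Max_in[OF fin[OF W] ne] unfolding K_def by (smt (verit) imageE mem_Collect_eq)
    have Bc: "B \<subseteq> carrier_vec d" using B vec_subspaceD(1)[OF W] by blast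
    have uc: "u \<in> carrier_vec d" using u vec_subspaceD(1)[OF U] by blast
    have "V.span B \<subseteq> W"
      using V.span_is_subset[OF B(1)] W unfolding subspace_def by blast
    then have "u \<notin> V.span B" using u by blast
    then have li: "\<not> V.lin_dep (B \<union> {u})"
      using V.lin_dep_iff_in_span[of B u] Bc B uc u by auto
    have "finite B" using V.li_le_dim(1)[OF V.fin_dim] Bc B by auto
    moreover have "u \<notin> B" using u B by blast
    ultimately have "card (B \<union> {u}) = Suc (card B)" by simp
    moreover have "card (B \<union> {u}) \<in> K U"
      unfolding K_def using li B \<open>W \<subset> U\<close> u by auto
    ultimately have "Suc (card B) \<le> Max (K U)" using Max_ge[OF fin[OF U]] by metis
    then show "Max (K W) < Max (K U)" using c by simp
  qed
qed

definition joint_eigen :: "nat \<Rightarrow> complex Matrix.mat set \<Rightarrow> complex Matrix.vec set" where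
  "joint_eigen d \<G> = {w\<in>carrier_vec d. \<forall>A\<in>\<G>. \<exists>c. A *\<^sub>v w = c \<cdot>\<^sub>v w}"

text \<open>
  If every matrix of the family acts on \<open>U\<close> as a scalar, all of \<open>U\<close> consists of joint eigenvectors.
  Otherwise some \<open>A\<close> splits \<open>U\<close> into eigenspaces that are proper subspaces; they are invariant under the
  family because it commutes, so induction on the dimension applies. An induction over the
  family would not do: it is the image of a whole torus in the application.
\<close>

lemma commuting_joint_eigen_sums:
  assumes ss: "\<And>A. A \<in> \<G> \<Longrightarrow> semisimple_mat d A"
    and comm: "\<And>A B. A \<in> \<G> \<Longrightarrow> B \<in> \<G> \<Longrightarrow> A * B = B * A"
    and "vec_subspace d U" and "\<And>A u. A \<in> \<G> \<Longrightarrow> u \<in> U \<Longrightarrow> A *\<^sub>v u \<in> U"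
  shows "U \<subseteq> vec_sums d (joint_eigen d \<G>)"
proof -
  obtain m :: "complex Matrix.vec set \<Rightarrow> nat" where
    m: "\<And>U W. vec_subspace d U \<Longrightarrow> vec_subspace d W \<Longrightarrow> W \<subset> U \<Longrightarrow> m W < m U"
    using subspace_measure by blast
  have Ac: "A \<in> carrier_mat d d" if "A \<in> \<G>" for A
    using ss[OF that] by (simp add: semisimple_mat_def)
  have Ec: "joint_eigen d \<G> \<subseteq> carrier_vec d" by (auto simp: joint_eigen_def)
  show ?thesis using assms(3,4)
  proof (induction "m U" arbitrary: U rule: less_induct)
    case less
    note D = vec_subspaceD[OF less.prems(1)]
    show ?case
    proof (cases "\<forall>A\<in>\<G>. \<exists>c. \<forall>u\<in>U. A *\<^sub>v u = c \<cdot>\<^sub>v u")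
      case True
      then have "U \<subseteq> joint_eigen d \<G>" using D(1) unfolding joint_eigen_def by blast
      then show ?thesis using vec_sums_gen[OF Ec] by blast
    next
      case False
      then obtain A where A: "A \<in> \<G>" and nscalar: "\<And>c. \<exists>u\<in>U. A *\<^sub>v u \<noteq> c \<cdot>\<^sub>v u" by blast
      have "{w\<in>U. \<exists>c. A *\<^sub>v w = c \<cdot>\<^sub>v w} \<subseteq> vec_sums d (joint_eigen d \<G>)"
      proof safe
        fix w c assume w: "w \<in> U" "A *\<^sub>v w = c \<cdot>\<^sub>v w"
        define W where "W = {w\<in>U. A *\<^sub>v w = c \<cdot>\<^sub>v w}"
        have Wcar: "w \<in> carrier_vec d" if "w \<in> W" for w using that D(1) unfolding W_def by auto
        have WS: "vec_subspace d W"
        proof (rule vec_subspaceI)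
          show "0\<^sub>v d \<in> W" unfolding W_def using D(2) Ac[OF A] by (auto intro!: eq_vecI)
          show "v + w \<in> W" if "v \<in> W" "w \<in> W" for v w
            using that D(3) Wcar[OF that(1)] Wcar[OF that(2)] Ac[OF A] unfolding W_def
            by (auto simp: mult_add_distrib_mat_vec smult_add_distrib_vec)
          show "k \<cdot>\<^sub>v v \<in> W" if "v \<in> W" for k v
            using that D(4) Wcar[OF that] Ac[OF A] unfolding W_def
            by (auto simp: mult_mat_vec smult_smult_assoc mult.commute)
        qed (use Wcar in blast)
        have inv: "B *\<^sub>v v \<in> W" if B: "B \<in> \<G>" and v: "v \<in> W" for B v
        proof -
          have "A *\<^sub>v (B *\<^sub>v v) = (A * B) *\<^sub>v v"
            using Ac[OF A] Ac[OF B] Wcar[OF v] by simp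
          also have "\<dots> = B *\<^sub>v (A *\<^sub>v v)"
            using comm[OF A B] Ac[OF A] Ac[OF B] Wcar[OF v] by simp
          also have "\<dots> = c \<cdot>\<^sub>v (B *\<^sub>v v)"
            using v Ac[OF B] Wcar[OF v] unfolding W_def by (auto simp: mult_mat_vec)
          finally show ?thesis using v B less.prems(2) unfolding W_def by blast
        qed
        have "W \<subset> U" using nscalar[of c] unfolding W_def by blast
        then have "m W < m U" using m less.prems(1) WS by blast
        then have "W \<subseteq> vec_sums d (joint_eigen d \<G>)" using less.hyps WS inv by blast
        then show "w \<in> vec_sums d (joint_eigen d \<G>)" using w unfolding W_def by blast
      qed
      moreover have "v \<in> vec_sums d {w\<in>U. \<exists>c. A *\<^sub>v w = c \<cdot>\<^sub>v w}" if "v \<in> U" for v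
        using semisimple_eigen_sums[OF ss[OF A] less.prems(1) that less.prems(2)[OF A]] .
      ultimately show ?thesis using vec_sums_trans[OF Ec] by blast
    qed
  qed
qed

lemma eigenbasis_from_sums:
  assumes E: "E \<subseteq> carrier_vec d" and gen: "carrier_vec d \<subseteq> vec_sums d E"
  obtains P Q where "P \<in> carrier_mat d d" "Q \<in> carrier_mat d d" "P * Q = 1\<^sub>m d" "Q * P = 1\<^sub>m d"
    "\<And>i. i < d \<Longrightarrow> Matrix.col P i \<in> E"
proof -
  interpret V: vec_space "TYPE(complex)" d .
  have "\<exists>B. finite B \<and> maximal B (\<lambda>B. B \<subseteq> E \<and> \<not> V.lin_dep B)"
  proof (rule maximal_exists)
    show "finite B \<and> card B \<le> V.dim" if "B \<subseteq> E \<and> \<not> V.lin_dep B" for B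
      using V.li_le_dim[OF V.fin_dim] that E by auto
    have "\<not> V.lin_dep {}" unfolding V.lin_dep_def by auto
    then show "{} \<subseteq> E \<and> \<not> V.lin_dep {}" by auto
  qed
  then obtain B where fin: "finite B" and B: "B \<subseteq> E" "\<not> V.lin_dep B"
    and mx: "\<And>C. B \<subseteq> C \<Longrightarrow> C \<subseteq> E \<Longrightarrow> \<not> V.lin_dep C \<Longrightarrow> C = B"
    unfolding maximal_def by auto
  have Bc: "B \<subseteq> carrier_vec d" using B E by blast
  have span_sub: "vec_subspace d (V.span B)"
    using V.span_is_subspace Bc by auto
  have "E \<subseteq> V.span B"
  proof
    fix e assume e: "e \<in> E"
    show "e \<in> V.span B"
    proof (rule ccontr)
      assume ne: "e \<notin> V.span B"
      then have eB: "e \<notin> B" using V.in_own_span[of B] Bc by auto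
      then have "\<not> V.lin_dep (B \<union> {e})"
        using V.lin_dep_iff_in_span[of B e] Bc B e E ne by auto
      then have "B \<union> {e} = B" using mx[of "B \<union> {e}"] B e by auto
      then show False using eB by blast
    qed
  qed
  then have span: "V.span B = carrier_vec d"
    using vec_sums_subset[OF span_sub] gen vec_subspaceD(1)[OF span_sub] by blast
  have "V.basis B" unfolding V.basis_def using span B Bc by auto
  then have cB: "card B = d" using V.dim_basis[OF fin] V.dim_is_n by auto
  obtain bs where bs: "set bs = B" "distinct bs" using finite_distinct_list[OF fin] by blast
  have len: "length bs = d" using cB bs distinct_card by fastforce
  define P where "P = mat_of_cols d bs"
  have Pc: "P \<in> carrier_mat d d" unfolding P_def using len by auto
  have cols: "cols P = bs" unfolding P_def using bs Bc by auto
  have "Determinant.det P \<noteq> 0"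
  proof
    assume "Determinant.det P = 0"
    then obtain x where "x \<in> carrier_vec d" "x \<noteq> 0\<^sub>v d" "P *\<^sub>v x = 0\<^sub>v d"
      using det_0_iff_vec_prod_zero[OF Pc] by blast
    then have "V.lin_dep (set (cols P))" using V.lin_depI[OF Pc] cols bs by blast
    then show False using cols bs B by simp
  qed
  then have "P \<in> Units (ring_mat TYPE(complex) d ())" 
    by (rule det_non_zero_imp_unit[OF Pc])
  then obtain Q where "Q \<in> carrier_mat d d" "P * Q = 1\<^sub>m d" "Q * P = 1\<^sub>m d"
    unfolding Units_def by (auto simp: ring_mat_simps)
  moreover have "Matrix.col P i \<in> E" if "i < d" for i
  proof -
    have "Matrix.col P i = cols P ! i" using that Pc by auto
    then show ?thesis using cols bs B that len nth_mem[of i bs] by auto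
  qed
  ultimately show thesis using that Pc by blast
qed

text \<open>
  The diagonalizing matrix does not depend on \<open>A\<close>; the diagonal is written as a function of \<open>A\<close> so that
  its multiplicativity and continuity in \<open>A\<close> can be seen.
\<close>

theorem commuting_semisimple_diagonalizable:
  assumes ss: "\<And>A. A \<in> \<G> \<Longrightarrow> semisimple_mat d A"
    and comm: "\<And>A B. A \<in> \<G> \<Longrightarrow> B \<in> \<G> \<Longrightarrow> A * B = B * A"
  obtains P Q where "P \<in> carrier_mat d d" "Q \<in> carrier_mat d d" "P * Q = 1\<^sub>m d" "Q * P = 1\<^sub>m d"
    "\<And>A. A \<in> \<G> \<Longrightarrow> A = P * mat_diag d (\<lambda>i. (Q * A * P) $$ (i, i)) * Q"
proof -
  have Ac: "A \<in> carrier_mat d d" if "A \<in> \<G>" for A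
    using ss[OF that] by (simp add: semisimple_mat_def)
  have "vec_subspace d (carrier_vec d)" by (rule vec_subspaceI) auto
  then have "carrier_vec d \<subseteq> vec_sums d (joint_eigen d \<G>)"
    using Ac by (intro commuting_joint_eigen_sums ss comm) (auto intro: mult_mat_vec_carrier)
  then obtain P Q where P: "P \<in> carrier_mat d d" and Q: "Q \<in> carrier_mat d d"
    and inv: "P * Q = 1\<^sub>m d" "Q * P = 1\<^sub>m d"
    and E: "\<And>i. i < d \<Longrightarrow> Matrix.col P i \<in> joint_eigen d \<G>"
    using eigenbasis_from_sums[of "joint_eigen d \<G>" d] unfolding joint_eigen_def by blast
  have "A = P * mat_diag d (\<lambda>i. (Q * A * P) $$ (i, i)) * Q" if A: "A \<in> \<G>" for A
  proof -
    have "\<forall>i\<in>{..<d}. \<exists>c. A *\<^sub>v Matrix.col P i = c \<cdot>\<^sub>v Matrix.col P i"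
      using E A unfolding joint_eigen_def by blast
    then obtain c where c: "\<And>i. i < d \<Longrightarrow> A *\<^sub>v Matrix.col P i = c i \<cdot>\<^sub>v Matrix.col P i"
      using bchoice[of "{..<d}"] by (metis lessThan_iff)
    have AP: "A * P = P * mat_diag d c"
    proof (rule eq_matI)
      fix i j assume "i < dim_row (P * mat_diag d c)" "j < dim_col (P * mat_diag d c)"
      then have ij: "i < d" "j < d" using P by (auto simp: mat_diag_def)
      have "(A * P) $$ (i, j) = (A *\<^sub>v Matrix.col P j) $ i" using ij P Ac[OF A] by auto
      also have "\<dots> = P $$ (i, j) * c j" using c[OF ij(2)] ij P by auto
      also have "\<dots> = (P * mat_diag d c) $$ (i, j)"
        using ij P by (subst mat_diag_mult_right[OF P]) auto
      finally show "(A * P) $$ (i, j) = (P * mat_diag d c) $$ (i, j)" .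
    qed (use P Ac[OF A] in \<open>auto simp: mat_diag_def\<close>)
    have "Q * A * P = Q * (A * P)" using P Q Ac[OF A] by (intro assoc_mult_mat) auto
    also have "\<dots> = (Q * P) * mat_diag d c"
      unfolding AP using P Q mat_diag_dim[of d c] by (intro assoc_mult_mat[symmetric])
    also have "\<dots> = mat_diag d c" unfolding inv by (rule left_mult_one_mat[OF mat_diag_dim])
    finally have D: "Q * A * P = mat_diag d c" .
    have diag: "mat_diag d (\<lambda>i. (Q * A * P) $$ (i, i)) = mat_diag d c"
      unfolding D by (rule eq_matI) (auto simp: mat_diag_def)
    have "A = A * (P * Q)" using inv Ac[OF A] by simp
    also have "\<dots> = A * P * Q" using P Q Ac[OF A] by (intro assoc_mult_mat[symmetric])
    finally show ?thesis unfolding diag AP .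
  qed
  then show thesis using that P Q inv by blast
qed

section \<open>Bounded groups of matrices\<close>

text \<open>
  Of a compact group of matrices only the boundedness of the entries is retained; it replaces
  averaging over the group.
\<close>

definition bounded_mat_group :: "nat \<Rightarrow> complex Matrix.mat set \<Rightarrow> bool" where
  "bounded_mat_group d \<G> \<longleftrightarrow>
     \<G> \<subseteq> carrier_mat d d \<and> (1\<^sub>m d \<in> \<G>) \<and> (\<forall>A\<in>\<G>. \<forall>B\<in>\<G>. A * B \<in> \<G>) \<and>
     (\<forall>A\<in>\<G>. \<exists>B\<in>\<G>. B * A = 1\<^sub>m d) \<and>
     (\<exists>K. \<forall>A\<in>\<G>. \<forall>i<d. \<forall>j<d. cmod (A $$ (i, j)) \<le> K)"

lemma bounded_mat_group_orbit_bounded: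
  assumes "bounded_mat_group d \<G>" "v \<in> carrier_vec d"
  obtains K where "\<And>A i. A \<in> \<G> \<Longrightarrow> i < d \<Longrightarrow> cmod ((A *\<^sub>v v) $ i) \<le> K"
proof -
  obtain K where K: "\<And>A i j. A \<in> \<G> \<Longrightarrow> i < d \<Longrightarrow> j < d \<Longrightarrow> cmod (A $$ (i, j)) \<le> K"
    using assms unfolding bounded_mat_group_def by blast
  have "cmod ((A *\<^sub>v v) $ i) \<le> (\<Sum>j\<in>{0..<d}. K * cmod (v $ j))" if A: "A \<in> \<G>" and i: "i < d" for A i
  proof -
    have "A \<in> carrier_mat d d" using A assms unfolding bounded_mat_group_def by blast
    then have "(A *\<^sub>v v) $ i = (\<Sum>j\<in>{0..<d}. A $$ (i, j) * v $ j)"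
      using i assms(2) by (auto simp: scalar_prod_def)
    also have "cmod \<dots> \<le> (\<Sum>j\<in>{0..<d}. K * cmod (v $ j))"
      using K[OF A i] by (intro sum_norm_le) (auto simp: norm_mult intro!: mult_right_mono)
    finally show ?thesis .
  qed
  then show thesis using that by blast
qed

lemma nonzero_vec_entry:
  assumes "v \<in> carrier_vec d" "v \<noteq> 0\<^sub>v d"
  obtains i where "i < d" "v $ i \<noteq> 0"
  using assms by (metis carrier_vecD eq_vecI index_zero_vec(1,2))

lemma bounded_mat_group_eigenvalue_le_1:
  assumes G: "bounded_mat_group d \<G>" and A: "A \<in> \<G>"
    and w: "w \<in> carrier_vec d" "w \<noteq> 0\<^sub>v d" "A *\<^sub>v w = c \<cdot>\<^sub>v w"
  shows "cmod c \<le> 1"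
proof (rule ccontr)
  assume "\<not> cmod c \<le> 1"
  then have c: "1 < cmod c" by simp
  have car: "B \<in> carrier_mat d d" if "B \<in> \<G>" for B
    using that G unfolding bounded_mat_group_def by blast
  have pow: "\<exists>B\<in>\<G>. B *\<^sub>v w = (c ^ n) \<cdot>\<^sub>v w" for n
  proof (induction n)
    case 0
    have "1\<^sub>m d *\<^sub>v w = (c ^ 0) \<cdot>\<^sub>v w" using w by auto
    then show ?case using G unfolding bounded_mat_group_def by blast
  next
    case (Suc n)
    then obtain B where B: "B \<in> \<G>" "B *\<^sub>v w = (c ^ n) \<cdot>\<^sub>v w" by blast
    have "(A * B) *\<^sub>v w = A *\<^sub>v (B *\<^sub>v w)" using car[OF A] car[OF B(1)] w(1) by simp
    also have "\<dots> = (c ^ Suc n) \<cdot>\<^sub>v w"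
      unfolding B(2) using car[OF A] w(1,3) by (auto simp: mult_mat_vec mult.commute)
    finally show ?case using G A B(1) unfolding bounded_mat_group_def by blast
  qed
  obtain K where K: "\<And>A i. A \<in> \<G> \<Longrightarrow> i < d \<Longrightarrow> cmod ((A *\<^sub>v w) $ i) \<le> K"
    using bounded_mat_group_orbit_bounded[OF G w(1)] by blast
  obtain i where i: "i < d" "w $ i \<noteq> 0" using nonzero_vec_entry w by blast
  obtain n where n: "K / cmod (w $ i) < cmod c ^ n" using real_arch_pow[OF c] by blast
  obtain B where B: "B \<in> \<G>" "B *\<^sub>v w = (c ^ n) \<cdot>\<^sub>v w" using pow by blast
  have "cmod c ^ n * cmod (w $ i) \<le> K"
    using K[OF B(1) i(1)] B(2) w(1) i(1) by (simp add: norm_mult norm_power)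
  then show False using n i by (simp add: field_simps)
qed

text \<open>
  The powers of \<open>A\<close> act on \<open>w\<close> by the powers of \<open>c\<close>, and those of the inverse by the powers of \<open>1 / c\<close>;
  both stay bounded.
\<close>

lemma bounded_mat_group_eigenvalue:
  assumes G: "bounded_mat_group d \<G>" and A: "A \<in> \<G>"
    and w: "w \<in> carrier_vec d" "w \<noteq> 0\<^sub>v d" "A *\<^sub>v w = c \<cdot>\<^sub>v w"
  shows "cmod c = 1"
proof -
  have car: "B \<in> carrier_mat d d" if "B \<in> \<G>" for B
    using that G unfolding bounded_mat_group_def by blast
  obtain B where B: "B \<in> \<G>" "B * A = 1\<^sub>m d" using G A unfolding bounded_mat_group_def by blast
  have "w = (B * A) *\<^sub>v w" using B w by simp
  also have "\<dots> = B *\<^sub>v (A *\<^sub>v w)" using car[OF A] car[OF B(1)] w by simp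
  also have "\<dots> = c \<cdot>\<^sub>v (B *\<^sub>v w)" unfolding w(3) using car[OF B(1)] w by (simp add: mult_mat_vec)
  finally have eq: "w = c \<cdot>\<^sub>v (B *\<^sub>v w)" .
  have Bw: "B *\<^sub>v w \<in> carrier_vec d" using car[OF B(1)] w by auto
  have "0 \<cdot>\<^sub>v (B *\<^sub>v w) = 0\<^sub>v d" using car[OF B(1)] by (auto intro!: eq_vecI)
  then have "c \<noteq> 0" using eq w(2) by auto
  then have "(1 / c) \<cdot>\<^sub>v w = (1 / c) \<cdot>\<^sub>v (c \<cdot>\<^sub>v (B *\<^sub>v w))" using eq by simp
  also have "\<dots> = B *\<^sub>v w" using \<open>c \<noteq> 0\<close> by (simp add: smult_smult_assoc)
  finally have "cmod (1 / c) \<le> 1"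
    using bounded_mat_group_eigenvalue_le_1[OF G B(1) w(1,2)] by metis
  then have "1 \<le> cmod c" using \<open>c \<noteq> 0\<close> by (simp add: norm_divide)
  then show ?thesis using bounded_mat_group_eigenvalue_le_1[OF G A w] by simp
qed

text \<open>
  If \<open>w = (A - c) v\<close> is a nonzero eigenvector, then \<open>A^n v = c^n v + n c^(n-1) w\<close>. As \<open>c\<close> has modulus 1, this
  grows linearly in \<open>n\<close>, while the orbit of \<open>v\<close> under a bounded group is bounded.
\<close>

lemma bounded_mat_group_semisimple:
  assumes G: "bounded_mat_group d \<G>" and A: "A \<in> \<G>"
  shows "semisimple_mat d A"
  unfolding semisimple_mat_def
proof (intro conjI allI ballI impI)
  have car: "B \<in> carrier_mat d d" if "B \<in> \<G>" for B
    using that G unfolding bounded_mat_group_def by blast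
  show "A \<in> carrier_mat d d" using car[OF A] .
  fix c v assume v: "v \<in> carrier_vec d" and 0: "shift_op A c (shift_op A c v) = 0\<^sub>v d"
  define w where "w = shift_op A c v"
  have w: "w \<in> carrier_vec d" unfolding w_def using car[OF A] v by simp
  have Aw: "A *\<^sub>v w = c \<cdot>\<^sub>v w" using 0 shift_op_eigen_iff[OF car[OF A] w] w_def by simp
  have Av: "A *\<^sub>v v = c \<cdot>\<^sub>v v + w"
    unfolding w_def shift_op_def using car[OF A] v by (auto intro!: eq_vecI)
  show "shift_op A c v = 0\<^sub>v d"
  proof (rule ccontr)
    assume "shift_op A c v \<noteq> 0\<^sub>v d"
    then have "w \<noteq> 0\<^sub>v d" by (simp add: w_def)
    then have c: "cmod c = 1" using bounded_mat_group_eigenvalue[OF G A w _ Aw] by simp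
    obtain i where i: "i < d" "w $ i \<noteq> 0" using nonzero_vec_entry w \<open>w \<noteq> 0\<^sub>v d\<close> by blast
    \<comment> \<open>The exponent \<open>n - 1\<close> is written as a division by \<open>c\<close> to cover \<open>n = 0\<close>.\<close>
    have pow: "\<exists>B\<in>\<G>. B *\<^sub>v v = (c ^ n) \<cdot>\<^sub>v v + (of_nat n * c ^ n / c) \<cdot>\<^sub>v w" for n
    proof (induction n)
      case 0
      have "1\<^sub>m d *\<^sub>v v = (c ^ 0) \<cdot>\<^sub>v v + (of_nat 0 * c ^ 0 / c) \<cdot>\<^sub>v w" using w v by (auto intro!: eq_vecI)
      then show ?case using G unfolding bounded_mat_group_def by blast
    next
      case (Suc n)
      then obtain B where B: "B \<in> \<G>"
        "B *\<^sub>v v = (c ^ n) \<cdot>\<^sub>v v + (of_nat n * c ^ n / c) \<cdot>\<^sub>v w" by blast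
      have c0: "c \<noteq> 0" using c by auto
      have "(A * B) *\<^sub>v v = A *\<^sub>v (B *\<^sub>v v)" using car[OF A] car[OF B(1)] v by simp
      also have "\<dots> = (c ^ n) \<cdot>\<^sub>v (A *\<^sub>v v) + (of_nat n * c ^ n / c) \<cdot>\<^sub>v (A *\<^sub>v w)"
        unfolding B(2) using car[OF A] w v
        by (subst mult_add_distrib_mat_vec[of A d d]) (auto simp: mult_mat_vec)
      also have "\<dots> = (c ^ Suc n) \<cdot>\<^sub>v v + (of_nat (Suc n) * c ^ Suc n / c) \<cdot>\<^sub>v w"
        unfolding Av Aw using w v c0
        by (intro eq_vecI) (auto simp: field_simps)
      finally show ?case using G A B(1) unfolding bounded_mat_group_def by blast
    qed
    obtain K where K: "\<And>A i. A \<in> \<G> \<Longrightarrow> i < d \<Longrightarrow> cmod ((A *\<^sub>v v) $ i) \<le> K"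
      using bounded_mat_group_orbit_bounded[OF G v] by blast
    obtain n where n: "(K + cmod (v $ i)) / cmod (w $ i) < real n" using reals_Archimedean2 by blast
    obtain B where B: "B \<in> \<G>" "B *\<^sub>v v = (c ^ n) \<cdot>\<^sub>v v + (of_nat n * c ^ n / c) \<cdot>\<^sub>v w"
      using pow by blast
    have "real n * cmod (w $ i) = cmod (of_nat n * c ^ n / c * w $ i)"
      using c by (simp add: norm_mult norm_divide norm_power)
    also have "of_nat n * c ^ n / c * w $ i = (B *\<^sub>v v) $ i - c ^ n * v $ i"
      unfolding B(2) using v w i by simp
    also have "cmod \<dots> \<le> cmod ((B *\<^sub>v v) $ i) + cmod (c ^ n * v $ i)" by (rule norm_triangle_ineq4)
    also have "\<dots> \<le> K + cmod (v $ i)"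
      using K[OF B(1) i(1)] c by (simp add: norm_mult norm_power)
    finally show False using n i by (simp add: field_simps)
  qed
qed

section \<open>Characters of the real line\<close>

lemma continuous_additive_real:
  fixes g :: "real \<Rightarrow> real"
  assumes cont: "continuous_on UNIV g" and add: "\<And>s t. g (s + t) = g s + g t"
  shows "g s = g 1 * s"
proof -
  have g0: "g 0 = 0" using add[of 0 0] by simp
  have gm: "g (- s) = - g s" for s using add[of s "- s"] g0 by simp
  have gn: "g (real n * x) = real n * g x" for n x
    by (induction n) (auto simp: g0 add algebra_simps)
  have gz: "g (of_int z * x) = of_int z * g x" for z x
  proof (cases "0 \<le> z")
    case True then show ?thesis using gn[of "nat z" x] by simp
  next
    case False then show ?thesis using gn[of "nat (- z)" x] gm[of "of_int z * x"] by simp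
  qed
  have gq: "g q = g 1 * q" if q: "q \<in> \<rat>" for q
  proof -
    obtain a b :: int where ab: "b > 0" "q = of_int a / of_int b" using q by (rule Rats_cases')
    have "of_int b * g q = g (of_int a * 1)" using gz[of b q] ab by simp
    also have "\<dots> = of_int a * g 1" by (rule gz)
    finally have "g q = of_int a * g 1 / of_int b"
      using ab(1) by (simp add: nonzero_eq_divide_eq mult.commute)
    then show ?thesis using ab(2) by simp
  qed
  have "closed {s. g s = g 1 * s}"
    by (rule closed_Collect_eq[OF cont continuous_on_mult[OF continuous_on_const continuous_on_id]])
  moreover have "\<rat> \<subseteq> {s. g s = g 1 * s}" using gq by blast
  ultimately have "closure \<rat> \<subseteq> {s. g s = g 1 * s}" by (rule closure_minimal[rotated])
  then show ?thesis unfolding Rats_closure_real by blast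
qed

text \<open>
  A continuous unitary character has a continuous logarithm because the line is contractible. The
  failure of this logarithm to be additive is a continuous function with values in a discrete set, so
  it vanishes; and a continuous additive function is linear.
\<close>

lemma unitary_character_real:
  fixes \<chi> :: "real \<Rightarrow> complex"
  assumes cont: "continuous_on UNIV \<chi>" and mult: "\<And>s t. \<chi> (s + t) = \<chi> s * \<chi> t"
    and unit: "\<And>s. cmod (\<chi> s) = 1"
  obtains a where "\<And>s. \<chi> s = exp (2 * pi * \<i> * complex_of_real (a * s))"
proof -
  have "Borsukian (UNIV :: real set)" by (simp add: convex_imp_Borsukian)
  then obtain g0 where g0: "continuous_on UNIV (complex_of_real \<circ> g0)" "\<And>s. \<chi> s = iexp (g0 s)"
    using cont unit unfolding Borsukian_continuous_logarithm_circle_real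
    by (metis UNIV_I image_subsetI mem_sphere_0 image_subset_iff_funcset)
  define g where "g s = g0 s - g0 0" for s
  have "continuous_on UNIV (Re \<circ> (complex_of_real \<circ> g0))"
    using g0(1) by (intro continuous_on_compose continuous_on_Re continuous_on_id) auto
  then have cg0: "continuous_on UNIV g0" by (simp add: comp_def)
  then have cg: "continuous_on UNIV g" unfolding g_def by (intro continuous_intros)
  have "\<chi> 0 = 1" using mult[of 0 0] unit[of 0] by auto
  then have \<chi>g: "\<chi> s = iexp (g s)" for s
    using g0(2)[of s] g0(2)[of 0] by (simp add: g_def exp_diff algebra_simps)
  have add: "g (s + t) = g s + g t" for s t
  proof -
    \<comment> \<open>The defect of additivity, in units of the period of \<open>t \<mapsto> exp (\<i> t)\<close>.\<close>
    define h where "h t = (g (s + t) - g s - g t) / (2 * pi)" for t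
    have ch: "continuous_on UNIV h"
      unfolding h_def by (intro continuous_intros continuous_on_compose2[OF cg]) auto
    have nz: "\<chi> s \<noteq> 0" for s using unit[of s] by auto
    have int: "h t \<in> \<int>" for t
    proof -
      have "iexp (g (s + t) - g s - g t) = \<chi> (s + t) / \<chi> s / \<chi> t"
        by (simp add: \<chi>g exp_diff right_diff_distrib)
      also have "\<dots> = 1" using mult[of s t] nz by simp
      finally have "\<exists>n::int. g (s + t) - g s - g t = of_int (2 * n) * pi"
        unfolding exp_eq_1 by simp
      then obtain n :: int where "g (s + t) - g s - g t = of_int (2 * n) * pi" by blast
      then have "h t = of_int n" unfolding h_def by simp
      then show ?thesis by simp
    qed
    have "\<exists>e>0. \<forall>y. y \<in> UNIV \<and> h y \<noteq> h x \<longrightarrow> e \<le> norm (h y - h x)" for x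
    proof (intro exI[of _ 1] conjI allI impI)
      fix y assume "y \<in> UNIV \<and> h y \<noteq> h x"
      then have "h y - h x \<in> \<int>" "h y - h x \<noteq> 0" using int by auto
      then show "1 \<le> norm (h y - h x)" unfolding real_norm_def by (rule Ints_nonzero_abs_ge1)
    qed simp
    then have "h constant_on UNIV" by (rule continuous_discrete_range_constant[OF connected_UNIV ch])
    moreover have "h 0 = 0" unfolding h_def g_def by simp
    ultimately have "h t = 0" unfolding constant_on_def by auto
    then show ?thesis unfolding h_def by simp
  qed
  have lin: "g s = g 1 * s" for s by (rule continuous_additive_real[OF cg add])
  have "\<chi> s = exp (2 * pi * \<i> * complex_of_real (g 1 / (2 * pi) * s))" for s
    using \<chi>g[of s] lin[of s] by simp
  then show thesis using that by blast
qed

lemma real_character_frequency_unique: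
  assumes "\<And>s::real. exp (2 * pi * \<i> * complex_of_real (a * s)) = exp (2 * pi * \<i> * complex_of_real (b * s))"
  shows "a = b"
proof (rule ccontr)
  assume "a \<noteq> b"
  \<comment> \<open>At this time the two characters differ by the factor \<open>-1\<close>.\<close>
  define s where "s = 1 / (2 * (a - b))"
  have "2 * pi * \<i> * complex_of_real (a * s) - 2 * pi * \<i> * complex_of_real (b * s)
      = 2 * pi * \<i> * complex_of_real ((a - b) * s)"
    unfolding left_diff_distrib of_real_diff by (rule right_diff_distrib[symmetric])
  also have "(a - b) * s = 1 / 2" unfolding s_def using \<open>a \<noteq> b\<close> by simp
  finally have "2 * pi * \<i> * complex_of_real (a * s) - 2 * pi * \<i> * complex_of_real (b * s) = \<i> * pi"
    by simp
  moreover have "exp (2 * pi * \<i> * complex_of_real (a * s) - 2 * pi * \<i> * complex_of_real (b * s)) = 1"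
    unfolding exp_diff using assms[of s] by simp
  ultimately show False by simp
qed

section \<open>Weight multiplicities from a diagonal form\<close>

lemma lie_scale_in_lie_alg:
  assumes "H \<in> lie_alg G X T"
  shows "lie_scale c H \<in> lie_alg G X T"
proof -
  have "continuous_map euclideanreal (subtopology X T) (H \<circ> (\<lambda>s. c * s))"
    using assms unfolding lie_alg_def by (intro continuous_map_compose[of _ euclideanreal]) (auto intro: continuous_intros)
  then show ?thesis using assms unfolding lie_alg_def lie_scale_def by (auto simp: comp_def distrib_left)
qed

text \<open>
  A single value of \<open>exp (2 \<pi> \<i> \<mu> H)\<close> determines \<open>\<mu> H\<close> only modulo integers. Since \<open>lie_alg\<close> is closed under
  real multiples of \<open>H\<close>, all of these values together determine it.
\<close>

lemma lie_dual_separated: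
  assumes \<mu>: "\<mu> \<in> lie_dual G X T" and \<nu>: "\<nu> \<in> lie_dual G X T"
    and eq: "\<And>H. H \<in> lie_alg G X T \<Longrightarrow>
      exp (2 * pi * \<i> * complex_of_real (\<mu> H)) = exp (2 * pi * \<i> * complex_of_real (\<nu> H))"
  shows "\<mu> = \<nu>"
proof
  fix H
  show "\<mu> H = \<nu> H"
  proof (cases "H \<in> lie_alg G X T")
    case False
    then show ?thesis using assms unfolding lie_dual_def by simp
  next
    case True
    show ?thesis
    proof (rule real_character_frequency_unique)
      fix s :: real
      have "\<mu> (lie_scale s H) = \<mu> H * s" "\<nu> (lie_scale s H) = \<nu> H * s"
        using True \<mu> \<nu> unfolding lie_dual_def by simp_all
      then show "exp (2 * pi * \<i> * complex_of_real (\<mu> H * s)) = exp (2 * pi * \<i> * complex_of_real (\<nu> H * s))"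
        using eq[OF lie_scale_in_lie_alg[OF True, of s]] by metis
    qed
  qed
qed

text \<open>
  In the eigenbasis \<open>P\<close> a vector lies in the weight space of \<open>\<nu>\<close> iff its coordinates at all \<open>i\<close> with
  \<open>w i \<noteq> \<nu>\<close> vanish, because distinct forms give distinct characters. So the columns of \<open>P\<close> of weight \<open>\<nu>\<close>
  are a basis of it. This is the only way in which dimensions are computed below, both for the
  representation and for its tensor powers.
\<close>

theorem weight_mult_diagonal:
  assumes P: "P \<in> carrier_mat m m" and Q: "Q \<in> carrier_mat m m"
    and PQ: "P * Q = 1\<^sub>m m" and QP: "Q * P = 1\<^sub>m m"
    and R: "\<And>H. H \<in> lie_alg G X T \<Longrightarrow>
      R (lie_exp H) = P * mat_diag m (\<lambda>i. exp (2 * pi * \<i> * complex_of_real (w i H))) * Q"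
    and w: "\<And>i. i < m \<Longrightarrow> w i \<in> lie_dual G X T" and \<nu>: "\<nu> \<in> lie_dual G X T"
  shows "weight_mult G X T m R \<nu> = card {i. i < m \<and> w i = \<nu>}"
proof -
  interpret V: vec_space "TYPE(complex)" m .
  define I where "I = {i. i < m \<and> w i = \<nu>}"
  define S where "S = Matrix.col P ` I"
  define D where "D H = mat_diag m (\<lambda>i. exp (2 * pi * \<i> * complex_of_real (w i H)))" for H
  have Dc: "D H \<in> carrier_mat m m" for H unfolding D_def by (rule mat_diag_dim)
  have R': "R (lie_exp H) = P * D H * Q" if "H \<in> lie_alg G X T" for H using R[OF that] by (simp add: D_def)
  have Qcol: "Q *\<^sub>v Matrix.col P i = unit_vec m i" if "i < m" for i
  proof -
    have "Q *\<^sub>v Matrix.col P i = Matrix.col (Q * P) i" using that P Q by (intro col_mult2[symmetric]) auto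
    then show ?thesis unfolding QP using that by simp
  qed
  have inj: "inj_on (Matrix.col P) {..<m}"
  proof (rule inj_onI)
    fix i j assume "i \<in> {..<m}" "j \<in> {..<m}" "Matrix.col P i = Matrix.col P j"
    then have ij: "i < m" "j < m" and eq: "Matrix.col P i = Matrix.col P j" by auto
    have "unit_vec m i = (unit_vec m j :: complex Matrix.vec)"
      unfolding Qcol[OF ij(1), symmetric] Qcol[OF ij(2), symmetric] eq by (rule refl)
    then have "(unit_vec m i :: complex Matrix.vec) $ i = unit_vec m j $ i" by simp
    then show "i = j" using ij by (auto split: if_splits)
  qed
  have Isub: "I \<subseteq> {..<m}" unfolding I_def by auto
  have finI: "finite I" using Isub finite_subset by blast
  have Sc: "S \<subseteq> carrier_vec m" unfolding S_def I_def using P by auto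
  have finS: "finite S" unfolding S_def using finI by simp
  have dist: "distinct (cols P)"
    unfolding cols_def distinct_map using inj P by (auto simp: atLeast0LessThan)
  have colsS: "S \<subseteq> set (cols P)"
    unfolding S_def I_def cols_def using P by auto
  have "\<not> V.lin_dep (set (cols P))"
  proof
    assume "V.lin_dep (set (cols P))"
    then obtain v where v: "v \<in> carrier_vec m" "v \<noteq> 0\<^sub>v m" "P *\<^sub>v v = 0\<^sub>v m"
      using V.lin_depE[OF P _ dist] by blast
    have "v = (Q * P) *\<^sub>v v" using QP v by simp
    also have "\<dots> = Q *\<^sub>v (P *\<^sub>v v)" using P Q v by simp
    also have "\<dots> = 0\<^sub>v m" unfolding v(3) using Q by (auto intro!: eq_vecI)
    finally show False using v by simp
  qed
  then have li: "\<not> V.lin_dep S" using V.subset_li_is_li colsS by blast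
  have col_in: "Matrix.col P i \<in> weight_space G X T m R \<nu>" if i: "i \<in> I" for i
    unfolding weight_space_def
  proof (intro CollectI conjI ballI)
    have im: "i < m" "w i = \<nu>" using i unfolding I_def by auto
    show "Matrix.col P i \<in> carrier_vec m" using P im by auto
    fix H assume H: "H \<in> lie_alg G X T"
    have "R (lie_exp H) *\<^sub>v Matrix.col P i = P *\<^sub>v (D H *\<^sub>v (Q *\<^sub>v Matrix.col P i))"
      unfolding R'[OF H] using P Q Dc im by (simp add: assoc_mult_mat_vec[of _ m m _ m])
    also have "D H *\<^sub>v (Q *\<^sub>v Matrix.col P i) = exp (2 * pi * \<i> * complex_of_real (\<nu> H)) \<cdot>\<^sub>v unit_vec m i"
      unfolding Qcol[OF im(1)] D_def using im by (auto simp: mat_diag_def intro!: eq_vecI)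
    also have "P *\<^sub>v \<dots> = exp (2 * pi * \<i> * complex_of_real (\<nu> H)) \<cdot>\<^sub>v Matrix.col P i"
      using P im by (auto simp: mult_mat_vec intro!: eq_vecI)
    finally show "R (lie_exp H) *\<^sub>v Matrix.col P i
      = exp (2 * pi * \<i> * complex_of_real (\<nu> H)) \<cdot>\<^sub>v Matrix.col P i" .
  qed
  have sub: "vec_subspace m (weight_space G X T m R \<nu>)"
  proof (rule vec_subspaceI)
    have Rc: "R (lie_exp H) \<in> carrier_mat m m" if "H \<in> lie_alg G X T" for H
      unfolding R'[OF that] using P Q Dc[of H] by auto
    show "weight_space G X T m R \<nu> \<subseteq> carrier_vec m" unfolding weight_space_def by auto
    have "R (lie_exp H) *\<^sub>v 0\<^sub>v m = c \<cdot>\<^sub>v 0\<^sub>v m" if "H \<in> lie_alg G X T" for H c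
      using Rc[OF that] by (auto intro!: eq_vecI)
    then show "0\<^sub>v m \<in> weight_space G X T m R \<nu>" unfolding weight_space_def by simp
    show "v + u \<in> weight_space G X T m R \<nu>"
      if "v \<in> weight_space G X T m R \<nu>" "u \<in> weight_space G X T m R \<nu>" for v u
      using that Rc unfolding weight_space_def
      by (auto simp: mult_add_distrib_mat_vec[OF Rc] smult_add_distrib_vec)
    show "c \<cdot>\<^sub>v v \<in> weight_space G X T m R \<nu>" if "v \<in> weight_space G X T m R \<nu>" for c v
      using that Rc unfolding weight_space_def
      by (auto simp: mult_mat_vec[OF Rc] smult_smult_assoc mult.commute)
  qed
  have "weight_space G X T m R \<nu> \<subseteq> V.span S"
  proof
    fix v assume v: "v \<in> weight_space G X T m R \<nu>"
    then have vc: "v \<in> carrier_vec m" unfolding weight_space_def by auto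
    define x where "x = Q *\<^sub>v v"
    have xc: "x \<in> carrier_vec m" unfolding x_def using Q vc by auto
    have Px: "P *\<^sub>v x = v"
    proof -
      have "P *\<^sub>v x = (P * Q) *\<^sub>v v" unfolding x_def using P Q vc by simp
      then show ?thesis using PQ vc by simp
    qed
    have x0: "x $ i = 0" if i: "i < m" "i \<notin> I" for i
    proof (rule ccontr)
      assume xi: "x $ i \<noteq> 0"
      have "w i = \<nu>"
      proof (rule lie_dual_separated[OF w[OF i(1)] \<nu>])
        fix H assume H: "H \<in> lie_alg G X T"
        define e where "e = exp (2 * pi * \<i> * complex_of_real (\<nu> H))"
        have "R (lie_exp H) *\<^sub>v v = e \<cdot>\<^sub>v v"
          using v H unfolding weight_space_def e_def by simp
        moreover have "R (lie_exp H) *\<^sub>v v = P *\<^sub>v (D H *\<^sub>v x)"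
          unfolding R'[OF H] x_def using P Q Dc vc by (simp add: assoc_mult_mat_vec[of _ m m _ m])
        ultimately have "Q *\<^sub>v (P *\<^sub>v (D H *\<^sub>v x)) = Q *\<^sub>v (e \<cdot>\<^sub>v v)" by simp
        also have "\<dots> = e \<cdot>\<^sub>v x" unfolding x_def using Q vc by (simp add: mult_mat_vec)
        also have "Q *\<^sub>v (P *\<^sub>v (D H *\<^sub>v x)) = (Q * P) *\<^sub>v (D H *\<^sub>v x)"
          using P Q Dc xc by (intro assoc_mult_mat_vec[symmetric]) (auto intro: mult_mat_vec_carrier)
        also have "\<dots> = D H *\<^sub>v x" unfolding QP using Dc xc by (intro one_mult_mat_vec) (auto intro: mult_mat_vec_carrier)
        finally have "(D H *\<^sub>v x) $ i = (e \<cdot>\<^sub>v x) $ i" by simp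
        moreover have "(D H *\<^sub>v x) $ i = exp (2 * pi * \<i> * complex_of_real (w i H)) * x $ i"
        proof -
          have "(D H *\<^sub>v x) $ i = (\<Sum>j\<in>{0..<m}. D H $$ (i, j) * x $ j)"
            using Dc[of H] xc i by (auto simp: scalar_prod_def)
          also have "\<dots> = (\<Sum>j\<in>{i}. D H $$ (i, j) * x $ j)"
            using i by (intro sum.mono_neutral_right) (auto simp: D_def mat_diag_def)
          finally show ?thesis using i by (simp add: D_def mat_diag_def)
        qed
        ultimately show "exp (2 * pi * \<i> * complex_of_real (w i H)) = exp (2 * pi * \<i> * complex_of_real (\<nu> H))"
          using xi xc i unfolding e_def by simp
      qed
      then show False using i unfolding I_def by simp
    qed
    \<comment> \<open>The columns are distinct, so coefficients indexed by \<open>i\<close> can be read as coefficients on vectors.\<close>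
    define a where "a u = x $ (inv_into I (Matrix.col P) u)" for u
    have injI: "inj_on (Matrix.col P) I" using inj Isub inj_on_subset by blast
    have "V.lincomb a S = v"
    proof (rule eq_vecI)
      show "dim_vec (V.lincomb a S) = dim_vec v" using V.lincomb_dim[OF finS Sc] vc by simp
      fix j assume "j < dim_vec v"
      then have j: "j < m" using vc by simp
      have "V.lincomb a S $ j = (\<Sum>u\<in>S. a u * u $ j)" by (rule V.lincomb_index[OF j Sc])
      also have "\<dots> = (\<Sum>i\<in>I. a (Matrix.col P i) * Matrix.col P i $ j)"
        unfolding S_def by (rule sum.reindex_cong[OF injI refl refl])
      also have "\<dots> = (\<Sum>i\<in>I. P $$ (j, i) * x $ i)"
        using injI P j Isub by (intro sum.cong refl) (auto simp: a_def)
      also have "\<dots> = (\<Sum>i\<in>{0..<m}. P $$ (j, i) * x $ i)"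
        using x0 Isub by (intro sum.mono_neutral_left) auto
      also have "\<dots> = (P *\<^sub>v x) $ j" using P xc j by (auto simp: scalar_prod_def)
      finally show "V.lincomb a S $ j = v $ j" unfolding Px .
    qed
    then show "v \<in> V.span S" unfolding V.span_def using finS by auto
  qed
  moreover have "V.span S \<subseteq> weight_space G X T m R \<nu>"
    using V.span_is_subset[of S "weight_space G X T m R \<nu>"] sub col_in
    unfolding subspace_def S_def by auto
  ultimately have ws: "weight_space G X T m R \<nu> = V.span S" by blast
  have "maximal S (\<lambda>U. U \<subseteq> S \<and> \<not> V.lin_dep U)" unfolding maximal_def using li by auto
  then have "vectorspace.dim class_ring (module_vec TYPE(complex) m\<lparr>carrier := V.span S\<rparr>) = card S"
    using V.dim_span[of S S] Sc finS by simp
  also have "card S = card I"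
    unfolding S_def using inj_on_subset[OF inj Isub] by (rule card_image)
  finally show ?thesis unfolding weight_mult_def ws I_def .
qed

section \<open>Tensor powers\<close>

text \<open>
  A product index set \<open>{..<a} \<times> {..<b}\<close> in lexicographic order, as in \<^const>\<open>kronecker\<close>.
\<close>

lemma sum_div_mod:
  fixes F :: "nat \<Rightarrow> nat \<Rightarrow> 'a::comm_monoid_add"
  shows "(\<Sum>k<a * b. F (k div b) (k mod b)) = (\<Sum>i<a. \<Sum>j<b. F i j)"
proof -
  have "(\<Sum>k<a * b. F (k div b) (k mod b)) = (\<Sum>i<a. \<Sum>k=i * b..<i * b + b. F (k div b) (k mod b))"
    by (rule sum.nat_group[symmetric])
  also have "\<dots> = (\<Sum>i<a. \<Sum>j<b. F i j)"
  proof (rule sum.cong[OF refl])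
    fix i
    have "(\<Sum>k=i * b..<i * b + b. F (k div b) (k mod b)) = (\<Sum>j=0..<b. F ((j + i * b) div b) ((j + i * b) mod b))"
      using sum.shift_bounds_nat_ivl[of "\<lambda>k. F (k div b) (k mod b)" 0 "i * b" b] by (simp add: add.commute)
    also have "\<dots> = (\<Sum>j<b. F i j)" by (intro sum.cong) auto
    finally show "(\<Sum>k=i * b..<i * b + b. F (k div b) (k mod b)) = (\<Sum>j<b. F i j)" .
  qed
  finally show ?thesis .
qed

lemma div_mod_bounds:
  fixes i :: nat
  assumes "i < a * b"
  shows "i div b < a" "i mod b < b"
proof -
  show "i div b < a" using assms by (simp add: less_mult_imp_div_less)
  have "b > 0" using assms by (cases b) auto
  then show "i mod b < b" by simp
qed

lemma kronecker_carrier [simp]: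
  "A \<in> carrier_mat a b \<Longrightarrow> B \<in> carrier_mat a' b' \<Longrightarrow> kronecker A B \<in> carrier_mat (a * a') (b * b')"
  unfolding kronecker_def by auto

lemma kronecker_mult:
  assumes "A \<in> carrier_mat a b" "C \<in> carrier_mat b c" "B \<in> carrier_mat a' b'" "D \<in> carrier_mat b' c'"
  shows "kronecker A B * kronecker C D = kronecker (A * C) (B * D)"
proof (rule eq_matI)
  have dims: "dim_row A = a" "dim_col A = b" "dim_row C = b" "dim_col C = c"
    "dim_row B = a'" "dim_col B = b'" "dim_row D = b'" "dim_col D = c'" using assms by auto
  fix i j assume "i < dim_row (kronecker (A * C) (B * D))" "j < dim_col (kronecker (A * C) (B * D))"
  then have ij: "i < a * a'" "j < c * c'" unfolding kronecker_def by (simp_all add: dims)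
  note bi = div_mod_bounds[OF ij(1)] and bj = div_mod_bounds[OF ij(2)]
  have "(kronecker A B * kronecker C D) $$ (i, j)
      = (\<Sum>k<b * b'. A $$ (i div a', k div b') * B $$ (i mod a', k mod b')
          * (C $$ (k div b', j div c') * D $$ (k mod b', j mod c')))"
    using ij by (simp add: kronecker_def dims scalar_prod_def atLeast0LessThan)
  also have "\<dots> = (\<Sum>k<b. \<Sum>l<b'. A $$ (i div a', k) * B $$ (i mod a', l)
          * (C $$ (k, j div c') * D $$ (l, j mod c')))"
    by (rule sum_div_mod)
  also have "\<dots> = (\<Sum>k<b. A $$ (i div a', k) * C $$ (k, j div c')) * (\<Sum>l<b'. B $$ (i mod a', l) * D $$ (l, j mod c'))"
    unfolding sum_product by (intro sum.cong refl) (simp add: mult_ac)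
  also have "\<dots> = (A * C) $$ (i div a', j div c') * (B * D) $$ (i mod a', j mod c')"
    using bi bj by (simp add: dims scalar_prod_def atLeast0LessThan)
  also have "\<dots> = kronecker (A * C) (B * D) $$ (i, j)"
    using ij by (simp add: kronecker_def dims)
  finally show "(kronecker A B * kronecker C D) $$ (i, j) = kronecker (A * C) (B * D) $$ (i, j)" .
qed (auto simp: kronecker_def)

lemma kronecker_mat_diag:
  "kronecker (mat_diag a f) (mat_diag b g) = mat_diag (a * b) (\<lambda>i. f (i div b) * g (i mod b))"
proof (rule eq_matI)
  fix i j assume "i < dim_row (mat_diag (a * b) (\<lambda>i. f (i div b) * g (i mod b)))"
    "j < dim_col (mat_diag (a * b) (\<lambda>i. f (i div b) * g (i mod b)))"
  then have ij: "i < a * b" "j < a * b" by (simp_all add: mat_diag_def)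
  have "i = j" if "i div b = j div b" "i mod b = j mod b" using that by (metis div_mult_mod_eq)
  then show "kronecker (mat_diag a f) (mat_diag b g) $$ (i, j)
      = mat_diag (a * b) (\<lambda>i. f (i div b) * g (i mod b)) $$ (i, j)"
    using ij div_mod_bounds[OF ij(1)] div_mod_bounds[OF ij(2)]
    by (auto simp: kronecker_def mat_diag_def)
qed (auto simp: kronecker_def mat_diag_def)

lemma kronecker_one: "kronecker (1\<^sub>m a) (1\<^sub>m b) = 1\<^sub>m (a * b)"
  using kronecker_mat_diag[of a "\<lambda>_. 1" b "\<lambda>_. 1"] by simp

text \<open>
  The weight of the tensor product of \<open>N\<close> basis vectors: the digits of \<open>i < d^N\<close> in base \<open>d\<close> are the indices
  of the factors, and their weights add up. When \<open>i\<close> is uniformly distributed, the digits are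
  independent and uniform.
\<close>

primrec tensor_weight :: "nat \<Rightarrow> (nat \<Rightarrow> 'h \<Rightarrow> real) \<Rightarrow> nat \<Rightarrow> nat \<Rightarrow> 'h \<Rightarrow> real" where
  "tensor_weight d w 0 i = (\<lambda>_. 0)"
| "tensor_weight d w (Suc N) i = form_add (w (i div d ^ N)) (tensor_weight d w N (i mod d ^ N))"

primrec kronecker_power :: "complex Matrix.mat \<Rightarrow> nat \<Rightarrow> complex Matrix.mat" where
  "kronecker_power A 0 = 1\<^sub>m 1"
| "kronecker_power A (Suc N) = kronecker A (kronecker_power A N)"

lemma kronecker_power_carrier [simp]:
  "A \<in> carrier_mat d d \<Longrightarrow> kronecker_power A N \<in> carrier_mat (d ^ N) (d ^ N)"
  by (induction N) auto

lemma tensor_power_eq: "tensor_power \<rho> N g = kronecker_power (\<rho> g) N"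
  by (induction N) auto

lemma kronecker_power_one: "kronecker_power (1\<^sub>m d) N = 1\<^sub>m (d ^ N)"
  by (induction N) (auto simp: kronecker_one)

lemma kronecker_power_mult:
  assumes "A \<in> carrier_mat d d" "B \<in> carrier_mat d d"
  shows "kronecker_power (A * B) N = kronecker_power A N * kronecker_power B N"
proof (induction N)
  case (Suc N)
  then show ?case
    using kronecker_mult[OF assms kronecker_power_carrier[OF assms(1)] kronecker_power_carrier[OF assms(2)]]
    by simp
qed simp

lemma kronecker_power_mat_diag:
  "kronecker_power (mat_diag d (\<lambda>i. exp (2 * pi * \<i> * complex_of_real (w i H)))) N
     = mat_diag (d ^ N) (\<lambda>i. exp (2 * pi * \<i> * complex_of_real (tensor_weight d w N i H)))"
proof (induction N)
  case (Suc N)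
  then show ?case
    by (simp add: kronecker_mat_diag form_add_def exp_add[symmetric] distrib_left)
qed simp

section \<open>Weights of the tensor power and the weight polytope\<close>

lemma form_hull_convex:
  assumes x: "x \<in> form_hull S" and y: "y \<in> form_hull S" and t: "0 \<le> t" "t \<le> 1"
  shows "form_add (form_scale (1 - t) x) (form_scale t y) \<in> form_hull S"
proof -
  obtain F c where F: "finite F" "F \<subseteq> S" "\<forall>\<mu>\<in>F. 0 \<le> c \<mu>" "(\<Sum>\<mu>\<in>F. c \<mu>) = 1"
    and xe: "x = (\<lambda>H. \<Sum>\<mu>\<in>F. c \<mu> * \<mu> H)" using x unfolding form_hull_def by blast
  obtain F' c' where F': "finite F'" "F' \<subseteq> S" "\<forall>\<mu>\<in>F'. 0 \<le> c' \<mu>" "(\<Sum>\<mu>\<in>F'. c' \<mu>) = 1"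
    and ye: "y = (\<lambda>H. \<Sum>\<mu>\<in>F'. c' \<mu> * \<mu> H)" using y unfolding form_hull_def by blast
  define k where "k \<mu> = (1 - t) * (if \<mu> \<in> F then c \<mu> else 0) + t * (if \<mu> \<in> F' then c' \<mu> else 0)" for \<mu>
  have sums: "(\<Sum>\<mu>\<in>F \<union> F'. k \<mu> * g \<mu>) = (1 - t) * (\<Sum>\<mu>\<in>F. c \<mu> * g \<mu>) + t * (\<Sum>\<mu>\<in>F'. c' \<mu> * g \<mu>)"
    for g :: "('a \<Rightarrow> real) \<Rightarrow> real"
  proof -
    have "(\<Sum>\<mu>\<in>F. c \<mu> * g \<mu>) = (\<Sum>\<mu>\<in>F \<union> F'. (if \<mu> \<in> F then c \<mu> else 0) * g \<mu>)"
      using F(1) F'(1) by (intro sum.mono_neutral_cong_left) auto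
    moreover have "(\<Sum>\<mu>\<in>F'. c' \<mu> * g \<mu>) = (\<Sum>\<mu>\<in>F \<union> F'. (if \<mu> \<in> F' then c' \<mu> else 0) * g \<mu>)"
      using F(1) F'(1) by (intro sum.mono_neutral_cong_left) auto
    moreover have "(\<Sum>\<mu>\<in>F \<union> F'. k \<mu> * g \<mu>) = (\<Sum>\<mu>\<in>F \<union> F'. (1 - t) * ((if \<mu> \<in> F then c \<mu> else 0) * g \<mu>)
        + t * ((if \<mu> \<in> F' then c' \<mu> else 0) * g \<mu>))"
      by (intro sum.cong refl) (simp add: k_def algebra_simps)
    ultimately show ?thesis by (simp only: sum.distrib sum_distrib_left)
  qed
  have "form_add (form_scale (1 - t) x) (form_scale t y) = (\<lambda>H. \<Sum>\<mu>\<in>F \<union> F'. k \<mu> * \<mu> H)"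
    unfolding form_add_def form_scale_def xe ye sums by (rule refl)
  moreover have "(\<Sum>\<mu>\<in>F \<union> F'. k \<mu>) = 1" using sums[of "\<lambda>_. 1"] F(4) F'(4) by simp
  moreover have "\<forall>\<mu>\<in>F \<union> F'. 0 \<le> k \<mu>" unfolding k_def using t F(3) F'(3) by auto
  ultimately show ?thesis
    unfolding form_hull_def using F(1,2) F'(1,2)
    by (intro CollectI exI[of _ "F \<union> F'"] exI[of _ k]) auto
qed

lemma form_hull_gen:
  assumes "x \<in> S"
  shows "x \<in> form_hull S"
  unfolding form_hull_def using assms
  by (intro CollectI exI[of _ "{x}"] exI[of _ "\<lambda>_. 1"]) auto

lemma form_hull_scale:
  assumes x: "x \<in> form_hull S" and r: "r \<noteq> 0"
  shows "form_scale r x \<in> form_hull (form_scale r ` S)"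
proof -
  obtain F c where F: "finite F" "F \<subseteq> S" "\<forall>\<mu>\<in>F. 0 \<le> c \<mu>" "(\<Sum>\<mu>\<in>F. c \<mu>) = 1"
    and xe: "x = (\<lambda>H. \<Sum>\<mu>\<in>F. c \<mu> * \<mu> H)" using x unfolding form_hull_def by blast
  \<comment> \<open>Multiplication by \<open>r \<noteq> 0\<close> is injective, so the coefficients can be transported along it.\<close>
  define k where "k \<nu> = c (form_scale (1 / r) \<nu>)" for \<nu>
  have inv: "form_scale (1 / r) (form_scale r \<mu>) = \<mu>" for \<mu> :: "'a \<Rightarrow> real"
    unfolding form_scale_def using r by simp
  have inj: "inj_on (form_scale r) F" by (rule inj_on_inverseI[of _ "form_scale (1 / r)"]) (rule inv)
  have "form_scale r x = (\<lambda>H. \<Sum>\<nu>\<in>form_scale r ` F. k \<nu> * \<nu> H)"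
    unfolding xe sum.reindex[OF inj] comp_def k_def inv
    by (simp add: form_scale_def sum_distrib_left algebra_simps)
  moreover have "(\<Sum>\<nu>\<in>form_scale r ` F. k \<nu>) = 1"
    unfolding sum.reindex[OF inj] comp_def k_def inv by (rule F(4))
  ultimately show ?thesis
    unfolding form_hull_def using F(1-3)
    by (intro CollectI exI[of _ "form_scale r ` F"] exI[of _ k]) (auto simp: k_def inv)
qed

lemma weyl_orbit_scale: "weyl_orbit G X T (form_scale r \<mu>) = form_scale r ` weyl_orbit G X T \<mu>"
proof -
  have "coadjoint G X T g (form_scale r \<mu>) = form_scale r (coadjoint G X T g \<mu>)" for g
    unfolding coadjoint_def form_scale_def by auto
  then show ?thesis unfolding weyl_orbit_def image_image by simp
qed

text \<open>
  A sum of \<open>N\<close> points of a convex set is \<open>N\<close> times their average. Keeping the average as the witness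
  \<open>a\<close> gives an induction that starts at the empty sum, where any point of the hull will do.
\<close>

lemma tensor_weight_in_hull:
  assumes d: "d > 0" and w: "\<And>i. i < d \<Longrightarrow> w i \<in> form_hull S" and i: "i < d ^ N"
  shows "\<exists>a\<in>form_hull S. tensor_weight d w N i = form_scale (real N) a"
  using i
proof (induction N arbitrary: i)
  case 0
  have "tensor_weight d w 0 i = form_scale (real 0) (w 0)" by (auto simp: form_scale_def)
  then show ?case using w[OF d] by blast
next
  case (Suc N)
  then have i: "i < d * d ^ N" by simp
  obtain a where a: "a \<in> form_hull S" "tensor_weight d w N (i mod d ^ N) = form_scale (real N) a"
    using Suc.IH[OF div_mod_bounds(2)[OF i]] by blast
  define t where "t = 1 / real (Suc N)"
  let ?b = "w (i div d ^ N)"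
  have b: "?b \<in> form_hull S" using w[OF div_mod_bounds(1)[OF i]] .
  have t: "real (Suc N) * t = 1" "real (Suc N) * (1 - t) = real N"
    unfolding t_def by (simp_all add: field_simps)
  have "tensor_weight d w (Suc N) i = form_scale (real (Suc N)) (form_add (form_scale (1 - t) a) (form_scale t ?b))"
  proof
    fix H
    have "real (Suc N) * ((1 - t) * a H + t * ?b H) = (real (Suc N) * (1 - t)) * a H + (real (Suc N) * t) * ?b H"
      by (simp only: distrib_left mult.assoc)
    then show "tensor_weight d w (Suc N) i H
        = form_scale (real (Suc N)) (form_add (form_scale (1 - t) a) (form_scale t ?b)) H"
      unfolding t by (simp add: a(2) form_scale_def form_add_def)
  qed
  moreover have "form_add (form_scale (1 - t) a) (form_scale t ?b) \<in> form_hull S"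
    using form_hull_convex[OF a(1) b, of t] unfolding t_def by simp
  ultimately show ?case by blast
qed

lemma form_add_in_lie_dual:
  "\<mu> \<in> lie_dual G X T \<Longrightarrow> \<nu> \<in> lie_dual G X T \<Longrightarrow> form_add \<mu> \<nu> \<in> lie_dual G X T"
  unfolding lie_dual_def form_add_def by (auto simp: algebra_simps)

lemma form_scale_in_lie_dual:
  "\<mu> \<in> lie_dual G X T \<Longrightarrow> form_scale c \<mu> \<in> lie_dual G X T"
  unfolding lie_dual_def form_scale_def by (auto simp: algebra_simps)

lemma zero_in_weight_lattice: "(\<lambda>_. 0) \<in> weight_lattice G X T"
  unfolding weight_lattice_def lie_dual_def by auto

lemma form_add_in_weight_lattice:
  "\<mu> \<in> weight_lattice G X T \<Longrightarrow> \<nu> \<in> weight_lattice G X T \<Longrightarrow> form_add \<mu> \<nu> \<in> weight_lattice G X T"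
  unfolding weight_lattice_def using form_add_in_lie_dual by (auto simp: form_add_def)

lemma tensor_weight_in_weight_lattice:
  assumes w: "\<And>i. i < d \<Longrightarrow> w i \<in> weight_lattice G X T" and i: "i < d ^ N"
  shows "tensor_weight d w N i \<in> weight_lattice G X T"
  using i
proof (induction N arbitrary: i)
  case 0
  show ?case using zero_in_weight_lattice by simp
next
  case (Suc N)
  then have i: "i < d * d ^ N" by simp
  show ?case
    using form_add_in_weight_lattice[OF w[OF div_mod_bounds(1)[OF i]] Suc.IH[OF div_mod_bounds(2)[OF i]]]
    by simp
qed

section \<open>The measure as the law of a random weight\<close>

text \<open>
  Counting with multiplicities is the image of counting. All mass sits on the finite image of
  \<open>v\<close>, so that the measure of a subset of \<open>A\<close> is a finite sum.
\<close>

lemma point_measure_multiplicity: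
  assumes fin: "finite I" and v: "v \<in> I \<rightarrow> A"
  shows "point_measure A (\<lambda>\<nu>. ennreal (real (card {i\<in>I. v i = \<nu>}) / real (card I)))
    = distr (uniform_count_measure I) (count_space A) v"
proof (rule measure_eqI)
  show "sets (point_measure A (\<lambda>\<nu>. ennreal (real (card {i\<in>I. v i = \<nu>}) / real (card I))))
    = sets (distr (uniform_count_measure I) (count_space A) v)"
    by (simp add: sets_point_measure)
  fix B assume "B \<in> sets (point_measure A (\<lambda>\<nu>. ennreal (real (card {i\<in>I. v i = \<nu>}) / real (card I))))"
  then have B: "B \<subseteq> A" by (simp add: sets_point_measure)
  define p where "p \<nu> = real (card {i\<in>I. v i = \<nu>}) / real (card I)" for \<nu>
  have p0: "0 \<le> p \<nu>" for \<nu> unfolding p_def by simp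
  have pz: "p \<nu> = 0" if "\<nu> \<notin> v ` I" for \<nu>
  proof -
    have "{i\<in>I. v i = \<nu>} = {}" using that by auto
    then have "card {i\<in>I. v i = \<nu>} = 0" by (simp only: card.empty)
    then show ?thesis unfolding p_def by (simp only: of_nat_0 div_0)
  qed
  have supp: "{a\<in>B. 0 < ennreal (p a)} \<subseteq> B \<inter> v ` I" using pz by fastforce
  have "finite (B \<inter> v ` I)" using fin by simp
  have "emeasure (point_measure A (\<lambda>\<nu>. ennreal (p \<nu>))) B = (\<Sum>a | a \<in> B \<and> 0 < ennreal (p a). ennreal (p a))"
    using finite_subset[OF supp \<open>finite (B \<inter> v ` I)\<close>] B by (rule emeasure_point_measure)
  also have "\<dots> = (\<Sum>a\<in>B \<inter> v ` I. ennreal (p a))"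
    using supp fin by (intro sum.mono_neutral_left) (auto simp: ennreal_eq_0_iff)
  also have "\<dots> = ennreal (\<Sum>a\<in>B \<inter> v ` I. p a)" using p0 by (intro sum_ennreal)
  also have "(\<Sum>a\<in>B \<inter> v ` I. p a) = real (card (v -` B \<inter> I)) / real (card I)"
  proof -
    have "(\<Sum>a\<in>B \<inter> v ` I. card {i\<in>v -` B \<inter> I. v i = a}) = card (v -` B \<inter> I)"
      using sum.group[of "v -` B \<inter> I" "B \<inter> v ` I" v "\<lambda>_. 1 :: nat"] fin by auto
    moreover have "{i\<in>v -` B \<inter> I. v i = a} = {i\<in>I. v i = a}" if "a \<in> B" for a using that by auto
    ultimately have "(\<Sum>a\<in>B \<inter> v ` I. card {i\<in>I. v i = a}) = card (v -` B \<inter> I)" by simp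
    then have "(\<Sum>a\<in>B \<inter> v ` I. real (card {i\<in>I. v i = a})) = real (card (v -` B \<inter> I))"
      by (simp only: of_nat_sum[symmetric])
    then show ?thesis unfolding p_def sum_divide_distrib[symmetric] by (rule arg_cong)
  qed
  also have "ennreal \<dots> = emeasure (distr (uniform_count_measure I) (count_space A) v) B"
    using v B fin
    by (subst emeasure_distr)
      (auto simp: space_uniform_count_measure emeasure_uniform_count_measure measurable_def sets_uniform_count_measure)
  finally show "emeasure (point_measure A (\<lambda>\<nu>. ennreal (real (card {i\<in>I. v i = \<nu>}) / real (card I)))) B
    = emeasure (distr (uniform_count_measure I) (count_space A) v) B"
    unfolding p_def .
qed

section \<open>The law of large numbers for tensor weights\<close>

text \<open>
  Bienayme's identity for \<open>N\<close> independent uniformly chosen weights, evaluated at \<open>H\<close>: the variance of the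
  sum is \<open>N\<close> times the variance of one summand. Splitting off the leading digit of \<open>i\<close>, the mixed terms
  vanish because the centred weights sum to 0. Both sides carry a factor \<open>d\<close> to avoid \<open>d^(N-1)\<close>.
\<close>

lemma tensor_weight_variance:
  fixes w :: "nat \<Rightarrow> 'h \<Rightarrow> real" and H :: 'h
  assumes d: "d > 0"
  defines "m \<equiv> (\<Sum>i<d. w i H) / real d"
  shows "real d * (\<Sum>i<d ^ N. (tensor_weight d w N i H - real N * m)\<^sup>2)
      = real N * real d ^ N * (\<Sum>i<d. (w i H - m)\<^sup>2)"
proof -
  define \<alpha> where "\<alpha> i = w i H - m" for i
  define \<beta> where "\<beta> N i = tensor_weight d w N i H - real N * m" for N i
  have \<alpha>0: "(\<Sum>i<d. \<alpha> i) = 0" unfolding \<alpha>_def m_def using d by (simp add: sum_subtractf)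
  have \<beta>S: "\<beta> (Suc N) i = \<alpha> (i div d ^ N) + \<beta> N (i mod d ^ N)" for N i
    unfolding \<alpha>_def \<beta>_def by (simp add: form_add_def algebra_simps)
  have \<beta>0: "(\<Sum>i<d ^ N. \<beta> N i) = 0" for N
  proof (induction N)
    case 0 show ?case by (simp add: \<beta>_def)
  next
    case (Suc N)
    have "(\<Sum>i<d ^ Suc N. \<beta> (Suc N) i) = (\<Sum>i<d. \<Sum>j<d ^ N. \<alpha> i + \<beta> N j)"
      unfolding \<beta>S power_Suc by (rule sum_div_mod)
    also have "\<dots> = 0" using Suc \<alpha>0 by (simp add: sum.distrib sum_distrib_left[symmetric])
    finally show ?case .
  qed
  have "real d * (\<Sum>i<d ^ N. (\<beta> N i)\<^sup>2) = real N * real d ^ N * (\<Sum>i<d. (\<alpha> i)\<^sup>2)"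
  proof (induction N)
    case 0 show ?case by (simp add: \<beta>_def)
  next
    case (Suc N)
    have "(\<Sum>i<d ^ Suc N. (\<beta> (Suc N) i)\<^sup>2) = (\<Sum>i<d. \<Sum>j<d ^ N. (\<alpha> i + \<beta> N j)\<^sup>2)"
      unfolding \<beta>S power_Suc by (rule sum_div_mod)
    also have "\<dots> = (\<Sum>i<d. real d ^ N * (\<alpha> i)\<^sup>2 + (\<Sum>j<d ^ N. (\<beta> N j)\<^sup>2))"
    proof (rule sum.cong[OF refl])
      fix i
      have "(\<Sum>j<d ^ N. (\<alpha> i + \<beta> N j)\<^sup>2)
          = (\<Sum>j<d ^ N. (\<alpha> i)\<^sup>2) + (\<Sum>j<d ^ N. (\<beta> N j)\<^sup>2) + 2 * \<alpha> i * (\<Sum>j<d ^ N. \<beta> N j)"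
        unfolding power2_sum sum.distrib sum_distrib_left by simp
      then show "(\<Sum>j<d ^ N. (\<alpha> i + \<beta> N j)\<^sup>2) = real d ^ N * (\<alpha> i)\<^sup>2 + (\<Sum>j<d ^ N. (\<beta> N j)\<^sup>2)"
        unfolding \<beta>0 by simp
    qed
    also have "\<dots> = real d ^ N * (\<Sum>i<d. (\<alpha> i)\<^sup>2) + real d * (\<Sum>j<d ^ N. (\<beta> N j)\<^sup>2)"
      by (simp add: sum.distrib sum_distrib_left)
    finally show ?case unfolding Suc by (simp add: algebra_simps)
  qed
  then show "real d * (\<Sum>i<d ^ N. (tensor_weight d w N i H - real N * m)\<^sup>2)
      = real N * real d ^ N * (\<Sum>i<d. (w i H - m)\<^sup>2)" unfolding \<alpha>_def \<beta>_def .
qed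

text \<open>
  A neighbourhood for pointwise convergence constrains only finitely many coordinates, so that
  estimates for a single \<open>H\<close> suffice.
\<close>

lemma fun_open_contains_box:
  fixes x :: "'h \<Rightarrow> real"
  assumes "open B" "x \<in> B"
  obtains J \<epsilon> where "finite J" "\<epsilon> > 0" "\<And>y. (\<And>h. h \<in> J \<Longrightarrow> \<bar>y h - x h\<bar> < \<epsilon>) \<Longrightarrow> y \<in> B"
proof -
  have "openin (product_topology (\<lambda>_::'h. euclideanreal) UNIV) B"
    using assms(1) by (simp add: open_fun_def)
  then obtain U where U: "x \<in> Pi\<^sub>E UNIV U" "\<And>h. open (U h)" "finite {h. U h \<noteq> UNIV}" "Pi\<^sub>E UNIV U \<subseteq> B"
    using product_topology_open_contains_basis[of "\<lambda>_. euclideanreal" UNIV B x] assms(2) by auto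
  define J where "J = {h. U h \<noteq> UNIV}"
  have "\<forall>h. \<exists>e>0. ball (x h) e \<subseteq> U h"
    using U(1,2) open_contains_ball by (metis PiE_mem UNIV_I)
  then obtain e where e: "\<And>h. e h > 0" "\<And>h. ball (x h) (e h) \<subseteq> U h" by metis
  define \<epsilon> where "\<epsilon> = Min (insert 1 (e ` J))"
  have fin: "finite (insert 1 (e ` J))" using U(3) unfolding J_def by simp
  have \<epsilon>: "\<epsilon> > 0" unfolding \<epsilon>_def using fin e(1) by (subst Min_gr_iff) auto
  have le: "\<epsilon> \<le> e h" if "h \<in> J" for h unfolding \<epsilon>_def using fin that by (intro Min_le) auto
  show thesis
  proof (rule that[of J \<epsilon>])
    fix y assume y: "\<And>h. h \<in> J \<Longrightarrow> \<bar>y h - x h\<bar> < \<epsilon>"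
    have "y h \<in> U h" for h
    proof (cases "h \<in> J")
      case True
      then have "y h \<in> ball (x h) (e h)" using y[OF True] le[OF True] by (simp add: dist_real_def abs_minus_commute)
      then show ?thesis using e(2) by blast
    qed (simp add: J_def)
    then show "y \<in> B" using U(4) by auto
  qed (use U(3) \<epsilon> in \<open>simp_all add: J_def\<close>)
qed

text \<open>
  Chebyshev's argument. Near \<open>m\<close> the function \<open>f\<close> is within \<open>r / 2\<close> of \<open>f m\<close>; elsewhere one of finitely
  many coordinates deviates by at least \<open>\<epsilon>\<close>, and the bound \<open>2 K\<close> for the oscillation of \<open>f\<close> is at most \<open>2 K / \<epsilon>^2\<close> times
  the squared deviation, whose mean is of order \<open>1 / N\<close>.
\<close>

theorem tensor_weight_law_of_large_numbers:
  fixes w :: "nat \<Rightarrow> 'h \<Rightarrow> real" and f :: "('h \<Rightarrow> real) \<Rightarrow> real"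
  assumes d: "d > 0"
    and mS: "m \<in> S" and m: "m = (\<lambda>h. (\<Sum>i<d. w i h) / real d)"
    and S: "\<And>N i. N \<ge> 1 \<Longrightarrow> i < d ^ N \<Longrightarrow> form_scale (1 / real N) (tensor_weight d w N i) \<in> S"
    and cont: "continuous_on S f" and bdd: "bounded (f ` S)"
  shows "(\<lambda>N. (\<Sum>i<d ^ N. f (form_scale (1 / real N) (tensor_weight d w N i))) / real d ^ N) \<longlonglongrightarrow> f m"
proof (rule LIMSEQ_I)
  fix r :: real assume r: "r > 0"
  obtain K where K: "\<And>y. y \<in> S \<Longrightarrow> \<bar>f y\<bar> \<le> K" using bdd unfolding bounded_iff by auto
  have K0: "0 \<le> K" using K[OF mS] by linarith
  have "\<exists>A. open A \<and> m \<in> A \<and> (\<forall>y\<in>S. y \<in> A \<longrightarrow> f y \<in> ball (f m) (r / 2))"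
    using cont mS r unfolding continuous_on_topological by (metis centre_in_ball half_gt_zero open_ball)
  then obtain A where A: "open A" "m \<in> A" "\<And>y. y \<in> S \<Longrightarrow> y \<in> A \<Longrightarrow> \<bar>f y - f m\<bar> < r / 2"
    by (auto simp: dist_real_def abs_minus_commute)
  obtain J \<epsilon> where J: "finite J" and \<epsilon>: "\<epsilon> > 0"
    and box: "\<And>y. (\<And>h. h \<in> J \<Longrightarrow> \<bar>y h - m h\<bar> < \<epsilon>) \<Longrightarrow> y \<in> A"
    using fun_open_contains_box[OF A(1,2)] by blast
  define V where "V h = (\<Sum>i<d. (w i h - m h)\<^sup>2)" for h
  \<comment> \<open>The error term will be \<open>L / N\<close>.\<close>
  define L where "L = 2 * K / \<epsilon>\<^sup>2 * (\<Sum>h\<in>J. V h) / real d"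
  obtain N0 :: nat where N0: "2 * L / r < real N0" using reals_Archimedean2 by blast
  show "\<exists>no. \<forall>N\<ge>no. norm ((\<Sum>i<d ^ N. f (form_scale (1 / real N) (tensor_weight d w N i))) / real d ^ N - f m) < r"
  proof (intro exI[of _ "max 1 N0"] allI impI)
    fix N assume N: "max 1 N0 \<le> N"
    define x where "x i = form_scale (1 / real N) (tensor_weight d w N i)" for i
    have xS: "x i \<in> S" if "i < d ^ N" for i unfolding x_def using S N that by simp
    have dN: "real d ^ N > 0" using d by simp
    have point: "\<bar>f (x i) - f m\<bar> \<le> r / 2 + 2 * K / \<epsilon>\<^sup>2 * (\<Sum>h\<in>J. (x i h - m h)\<^sup>2)" if i: "i < d ^ N" for i
    proof (cases "\<forall>h\<in>J. \<bar>x i h - m h\<bar> < \<epsilon>")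
      case True
      then have "\<bar>f (x i) - f m\<bar> < r / 2" using A(3)[OF xS[OF i]] box by blast
      moreover have "0 \<le> 2 * K / \<epsilon>\<^sup>2 * (\<Sum>h\<in>J. (x i h - m h)\<^sup>2)" using K0 by (simp add: sum_nonneg)
      ultimately show ?thesis by linarith
    next
      case False
      then obtain h where h: "h \<in> J" "\<epsilon> \<le> \<bar>x i h - m h\<bar>" by force
      have "\<epsilon>\<^sup>2 \<le> (x i h - m h)\<^sup>2" using h(2) \<epsilon> by (metis abs_le_square_iff abs_of_pos)
      also have "\<dots> \<le> (\<Sum>h\<in>J. (x i h - m h)\<^sup>2)"
        using h(1) J by (intro member_le_sum) auto
      finally have "1 \<le> (\<Sum>h\<in>J. (x i h - m h)\<^sup>2) / \<epsilon>\<^sup>2" using \<epsilon> by simp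
      then have "2 * K * 1 \<le> 2 * K * ((\<Sum>h\<in>J. (x i h - m h)\<^sup>2) / \<epsilon>\<^sup>2)"
        using K0 by (intro mult_left_mono) auto
      moreover have "\<bar>f (x i) - f m\<bar> \<le> 2 * K" using K[OF xS[OF i]] K[OF mS] by linarith
      ultimately show ?thesis using r by simp
    qed
    have second: "(\<Sum>i<d ^ N. (x i h - m h)\<^sup>2) = real d ^ N * V h / (real N * real d)" for h
    proof -
      have "(x i h - m h)\<^sup>2 = (tensor_weight d w N i h - real N * m h)\<^sup>2 / (real N)\<^sup>2" for i
      proof -
        have "x i h - m h = (tensor_weight d w N i h - real N * m h) / real N"
          unfolding x_def form_scale_def using N by (simp add: diff_divide_distrib)
        then show ?thesis by (simp add: power_divide)
      qed
      then have "(\<Sum>i<d ^ N. (x i h - m h)\<^sup>2)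
          = (\<Sum>i<d ^ N. (tensor_weight d w N i h - real N * m h)\<^sup>2) / (real N)\<^sup>2"
        by (simp add: sum_divide_distrib)
      moreover have "real d * (\<Sum>i<d ^ N. (tensor_weight d w N i h - real N * m h)\<^sup>2) = real N * real d ^ N * V h"
        using tensor_weight_variance[OF d, where w = w and H = h and N = N] unfolding V_def m by simp
      then have "(\<Sum>i<d ^ N. (tensor_weight d w N i h - real N * m h)\<^sup>2) = real N * real d ^ N * V h / real d"
        using d by (simp add: nonzero_eq_divide_eq mult.commute)
      ultimately show ?thesis using N d by (simp add: power2_eq_square)
    qed
    have "(\<Sum>i<d ^ N. f (x i)) / real d ^ N - f m = (\<Sum>i<d ^ N. f (x i) - f m) / real d ^ N"
      using dN by (simp add: sum_subtractf diff_divide_distrib)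
    also have "norm \<dots> \<le> (\<Sum>i<d ^ N. \<bar>f (x i) - f m\<bar>) / real d ^ N"
      using dN sum_abs[of "\<lambda>i. f (x i) - f m" "{..<d ^ N}"] by (simp add: divide_right_mono)
    also have "\<dots> \<le> (\<Sum>i<d ^ N. r / 2 + 2 * K / \<epsilon>\<^sup>2 * (\<Sum>h\<in>J. (x i h - m h)\<^sup>2)) / real d ^ N"
      using dN point by (intro divide_right_mono sum_mono) auto
    also have "(\<Sum>i<d ^ N. r / 2 + 2 * K / \<epsilon>\<^sup>2 * (\<Sum>h\<in>J. (x i h - m h)\<^sup>2))
        = real d ^ N * (r / 2) + 2 * K / \<epsilon>\<^sup>2 * (\<Sum>h\<in>J. \<Sum>i<d ^ N. (x i h - m h)\<^sup>2)"
      unfolding sum.distrib sum_distrib_left[symmetric] by (subst sum.swap) simp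
    also have "\<dots> = real d ^ N * (r / 2 + L / real N)"
      unfolding second L_def sum_divide_distrib[symmetric] sum_distrib_left[symmetric]
      by (simp add: algebra_simps)
    also have "\<dots> / real d ^ N = r / 2 + L / real N" using dN by simp
    also have "\<dots> < r"
    proof -
      have "2 * L / r < real N" using N0 N by linarith
      then have "2 * L < r * real N" using r by (simp add: pos_divide_less_eq mult.commute)
      then have "L / real N < r / 2" using N by (simp add: pos_divide_less_eq)
      then show ?thesis by linarith
    qed
    finally show "norm ((\<Sum>i<d ^ N. f (form_scale (1 / real N) (tensor_weight d w N i))) / real d ^ N - f m) < r"
      unfolding x_def .
  qed
qed

section \<open>Weights of a representation of a torus\<close>

lemma torus_in_commutes:
  assumes T: "torus_in G X T" and sub: "T \<subseteq> topspace X" and x: "x \<in> T" and y: "y \<in> T"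
  shows "x \<otimes>\<^bsub>G\<^esub> y = y \<otimes>\<^bsub>G\<^esub> x"
proof -
  obtain r :: nat and f where
    hom: "homeomorphic_map (product_topology (\<lambda>_. top_of_set (sphere (0::complex) 1)) {..<r}) (subtopology X T) f"
    and mult: "\<And>a b. a \<in> {..<r} \<rightarrow>\<^sub>E sphere 0 1 \<Longrightarrow> b \<in> {..<r} \<rightarrow>\<^sub>E sphere 0 1 \<Longrightarrow>
        f (\<lambda>i\<in>{..<r}. a i * b i) = f a \<otimes>\<^bsub>G\<^esub> f b"
    using T unfolding torus_in_def by blast
  have "f ` ({..<r} \<rightarrow>\<^sub>E sphere 0 1) = T"
    using homeomorphic_imp_surjective_map[OF hom] sub by (simp add: Int_absorb1)
  then obtain a b where a: "a \<in> {..<r} \<rightarrow>\<^sub>E sphere 0 1" "x = f a"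
    and b: "b \<in> {..<r} \<rightarrow>\<^sub>E sphere 0 1" "y = f b" using x y by blast
  show ?thesis unfolding a(2) b(2) mult[OF a(1) b(1), symmetric] mult[OF b(1) a(1), symmetric]
    by (simp add: mult.commute)
qed

lemma rep_image_bounded_mat_group:
  assumes rep: "is_rep G X d \<rho>" and X: "compact_space X" "topspace X = carrier G"
    and T: "subgroup T G" and G: "Group.group G"
  shows "bounded_mat_group d (\<rho> ` T)"
proof -
  interpret group G by (rule G)
  have Tc: "t \<in> carrier G" if "t \<in> T" for t using subgroup.mem_carrier[OF T that] .
  have \<rho>: "\<rho> g \<in> carrier_mat d d" if "g \<in> carrier G" for g using rep that unfolding is_rep_def by blast
  have mult: "\<rho> (g \<otimes>\<^bsub>G\<^esub> h) = \<rho> g * \<rho> h" if "g \<in> carrier G" "h \<in> carrier G" for g h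
    using rep that unfolding is_rep_def by blast
  have one: "\<rho> \<one>\<^bsub>G\<^esub> = 1\<^sub>m d" using rep unfolding is_rep_def by blast
  have bdd: "bounded ((\<lambda>g. \<rho> g $$ (i, j)) ` carrier G)" if "i < d" "j < d" for i j
  proof -
    have "continuous_map X euclidean (\<lambda>g. \<rho> g $$ (i, j))" using rep that unfolding is_rep_def by blast
    then have "compactin euclidean ((\<lambda>g. \<rho> g $$ (i, j)) ` topspace X)"
      using X(1) unfolding compact_space_def by (rule image_compactin[rotated])
    then show ?thesis unfolding X(2) using compact_imp_bounded by simp
  qed
  have "bounded (\<Union>(i, j)\<in>{..<d} \<times> {..<d}. (\<lambda>g. \<rho> g $$ (i, j)) ` carrier G)"
    using bdd by (intro bounded_UN) auto
  then obtain K where K: "\<And>z. z \<in> (\<Union>(i, j)\<in>{..<d} \<times> {..<d}. (\<lambda>g. \<rho> g $$ (i, j)) ` carrier G) \<Longrightarrow> cmod z \<le> K"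
    unfolding bounded_iff by blast
  show ?thesis
    unfolding bounded_mat_group_def
  proof (intro conjI ballI exI[of _ K] allI impI)
    show "\<rho> ` T \<subseteq> carrier_mat d d" using \<rho> Tc by auto
    show "1\<^sub>m d \<in> \<rho> ` T" using one subgroup.one_closed[OF T] by (metis imageI)
    show "A * B \<in> \<rho> ` T" if "A \<in> \<rho> ` T" "B \<in> \<rho> ` T" for A B
      using that mult Tc subgroup.m_closed[OF T] by (auto simp: image_iff) metis
    show "\<exists>B\<in>\<rho> ` T. B * A = 1\<^sub>m d" if "A \<in> \<rho> ` T" for A
    proof -
      obtain t where t: "t \<in> T" "A = \<rho> t" using \<open>A \<in> \<rho> ` T\<close> by blast
      have "\<rho> (inv\<^bsub>G\<^esub> t) * \<rho> t = 1\<^sub>m d"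
        using mult[of "inv\<^bsub>G\<^esub> t" t] Tc[OF t(1)] one by simp
      then show ?thesis using t subgroup.m_inv_closed[OF T t(1)] by blast
    qed
    show "cmod (A $$ (i, j)) \<le> K" if "A \<in> \<rho> ` T" "i < d" "j < d" for A i j
      using that Tc by (intro K) auto
  qed
qed

lemma lie_algD:
  assumes "H \<in> lie_alg G X T" "subgroup T G"
  shows "H s \<in> T" and "H (s + t) = H s \<otimes>\<^bsub>G\<^esub> H t" and "continuous_map euclideanreal X H"
proof -
  have c: "continuous_map euclideanreal (subtopology X T) H" and "\<forall>s t. H (s + t) = H s \<otimes>\<^bsub>G\<^esub> H t"
    using assms(1) unfolding lie_alg_def by auto
  then show "H (s + t) = H s \<otimes>\<^bsub>G\<^esub> H t" by blast
  show "H s \<in> T" "continuous_map euclideanreal X H"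
    using c unfolding continuous_map_in_subtopology by auto
qed

text \<open>
  The product of two one-parameter subgroups is one again because their values commute.
\<close>

lemma lie_add_in_lie_alg:
  assumes top: "topological_group G X" and T: "subgroup T G"
    and comm: "\<And>x y. x \<in> T \<Longrightarrow> y \<in> T \<Longrightarrow> x \<otimes>\<^bsub>G\<^esub> y = y \<otimes>\<^bsub>G\<^esub> x"
    and H: "H \<in> lie_alg G X T" and K: "K \<in> lie_alg G X T"
  shows "lie_add G H K \<in> lie_alg G X T"
proof -
  interpret group G using top unfolding topological_group_def by blast
  note h = lie_algD[OF H T] and k = lie_algD[OF K T]
  have Tc: "t \<in> carrier G" if "t \<in> T" for t using subgroup.mem_carrier[OF T that] .
  have "continuous_map euclideanreal (prod_topology X X) (\<lambda>s. (H s, K s))"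
    using h(3) k(3) by (simp add: continuous_map_pairedI)
  then have "continuous_map euclideanreal X ((\<lambda>(x, y). x \<otimes>\<^bsub>G\<^esub> y) \<circ> (\<lambda>s. (H s, K s)))"
    using top unfolding topological_group_def by (intro continuous_map_compose) auto
  then have "continuous_map euclideanreal (subtopology X T) (lie_add G H K)"
    unfolding continuous_map_in_subtopology lie_add_def
    using subgroup.m_closed[OF T h(1) k(1)] by (auto simp: comp_def)
  moreover have "lie_add G H K (s + t) = lie_add G H K s \<otimes>\<^bsub>G\<^esub> lie_add G H K t" for s t
  proof -
    have c: "H s \<in> carrier G" "H t \<in> carrier G" "K s \<in> carrier G" "K t \<in> carrier G"
      using Tc h(1) k(1) by auto
    have "lie_add G H K (s + t) = H s \<otimes>\<^bsub>G\<^esub> ((H t \<otimes>\<^bsub>G\<^esub> K s) \<otimes>\<^bsub>G\<^esub> K t)"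
      unfolding lie_add_def h(2) k(2) using c by (simp add: m_assoc)
    also have "H t \<otimes>\<^bsub>G\<^esub> K s = K s \<otimes>\<^bsub>G\<^esub> H t" using comm h(1) k(1) by blast
    also have "H s \<otimes>\<^bsub>G\<^esub> ((K s \<otimes>\<^bsub>G\<^esub> H t) \<otimes>\<^bsub>G\<^esub> K t) = lie_add G H K s \<otimes>\<^bsub>G\<^esub> lie_add G H K t"
      unfolding lie_add_def using c by (simp add: m_assoc)
    finally show ?thesis .
  qed
  ultimately show ?thesis unfolding lie_alg_def by blast
qed

text \<open>
  The image of the torus is a bounded commutative group of matrices, hence simultaneously
  diagonalizable. Along a one-parameter subgroup \<open>H\<close> each diagonal entry is a continuous unitary
  character of the line; its frequency is the value of the weight at \<open>H\<close>. The weight is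
  additive and homogeneous because the frequency of a character is unique, and integral because the
  diagonal entries are 1 at the identity.
\<close>

theorem torus_rep_weights:
  assumes top: "topological_group G X" and X: "compact_space X"
    and T: "torus_in G X T" and rep: "is_rep G X d \<rho>"
  obtains P Q w where "P \<in> carrier_mat d d" "Q \<in> carrier_mat d d" "P * Q = 1\<^sub>m d" "Q * P = 1\<^sub>m d"
    "\<And>i. i < d \<Longrightarrow> w i \<in> weight_lattice G X T"
    "\<And>H. H \<in> lie_alg G X T \<Longrightarrow>
      \<rho> (lie_exp H) = P * mat_diag d (\<lambda>i. exp (2 * pi * \<i> * complex_of_real (w i H))) * Q"
proof -
  interpret group G using top unfolding topological_group_def by blast
  have tsp: "topspace X = carrier G" using top unfolding topological_group_def by blast
  have sT: "subgroup T G" using T unfolding torus_in_def by blast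
  have Tc: "t \<in> carrier G" if "t \<in> T" for t using subgroup.mem_carrier[OF sT that] .
  have comm: "x \<otimes>\<^bsub>G\<^esub> y = y \<otimes>\<^bsub>G\<^esub> x" if "x \<in> T" "y \<in> T" for x y
    using torus_in_commutes[OF T _ that] Tc tsp by blast
  have \<rho>: "\<rho> g \<in> carrier_mat d d" if "g \<in> carrier G" for g using rep that unfolding is_rep_def by blast
  have \<rho>mult: "\<rho> (g \<otimes>\<^bsub>G\<^esub> h) = \<rho> g * \<rho> h" if "g \<in> carrier G" "h \<in> carrier G" for g h
    using rep that unfolding is_rep_def by blast
  have bg: "bounded_mat_group d (\<rho> ` T)"
    by (rule rep_image_bounded_mat_group[OF rep X tsp sT is_group])
  have cm: "A * B = B * A" if "A \<in> \<rho> ` T" "B \<in> \<rho> ` T" for A B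
    using that comm \<rho>mult Tc by (auto simp: image_iff) metis
  obtain P Q where P: "P \<in> carrier_mat d d" and Q: "Q \<in> carrier_mat d d"
    and PQ: "P * Q = 1\<^sub>m d" and QP: "Q * P = 1\<^sub>m d"
    and diag: "\<And>A. A \<in> \<rho> ` T \<Longrightarrow> A = P * mat_diag d (\<lambda>i. (Q * A * P) $$ (i, i)) * Q"
    using commuting_semisimple_diagonalizable[OF bounded_mat_group_semisimple[OF bg] cm] by blast
  define \<chi> where "\<chi> i t = (Q * \<rho> t * P) $$ (i, i)" for i t
  define D where "D t = mat_diag d (\<lambda>i. \<chi> i t)" for t
  have Dc: "D t \<in> carrier_mat d d" for t unfolding D_def by (rule mat_diag_dim)
  have \<rho>D: "\<rho> t = P * D t * Q" if "t \<in> T" for t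
    unfolding D_def \<chi>_def by (rule diag) (use that in blast)
  have \<rho>P: "\<rho> t * P = P * D t" if t: "t \<in> T" for t
  proof -
    have "\<rho> t * P = P * D t * (Q * P)" unfolding \<rho>D[OF t] using P Q Dc[of t] by (intro assoc_mult_mat) auto
    then show ?thesis unfolding QP using P Dc[of t] by simp
  qed
  have DQ: "D t = Q * \<rho> t * P" if t: "t \<in> T" for t
  proof -
    have "Q * \<rho> t * P = Q * (P * D t)"
      unfolding \<rho>P[OF t, symmetric] using P Q \<rho>[OF Tc[OF t]] by (intro assoc_mult_mat)
    also have "\<dots> = (Q * P) * D t" using P Q Dc[of t] by (intro assoc_mult_mat[symmetric])
    finally show ?thesis unfolding QP using Dc[of t] by simp
  qed
  have \<chi>mult: "\<chi> i (t \<otimes>\<^bsub>G\<^esub> u) = \<chi> i t * \<chi> i u" if i: "i < d" and t: "t \<in> T" and u: "u \<in> T" for i t u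
  proof -
    have "P * D (t \<otimes>\<^bsub>G\<^esub> u) = \<rho> t * \<rho> u * P"
      using \<rho>P[OF subgroup.m_closed[OF sT t u]] \<rho>mult[OF Tc[OF t] Tc[OF u]] by simp
    also have "\<dots> = \<rho> t * (P * D u)"
      unfolding \<rho>P[OF u, symmetric] using P \<rho>[OF Tc[OF t]] \<rho>[OF Tc[OF u]] by (intro assoc_mult_mat)
    also have "\<dots> = (\<rho> t * P) * D u"
      using P \<rho>[OF Tc[OF t]] Dc[of u] by (intro assoc_mult_mat[symmetric])
    also have "\<dots> = P * (D t * D u)" unfolding \<rho>P[OF t] using P Dc[of t] Dc[of u] by (intro assoc_mult_mat)
    finally have "Q * (P * D (t \<otimes>\<^bsub>G\<^esub> u)) = Q * (P * (D t * D u))" by simp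
    moreover have "Q * (P * Z) = Z" if "Z \<in> carrier_mat d d" for Z
      using assoc_mult_mat[OF Q P that] QP that by simp
    ultimately have "D (t \<otimes>\<^bsub>G\<^esub> u) = D t * D u" using Dc by (metis mult_carrier_mat)
    then have "D (t \<otimes>\<^bsub>G\<^esub> u) $$ (i, i) = mat_diag d (\<lambda>i. \<chi> i t * \<chi> i u) $$ (i, i)"
      unfolding D_def by simp
    then show ?thesis unfolding D_def using i by (simp add: mat_diag_def)
  qed
  have \<chi>unit: "cmod (\<chi> i t) = 1" if i: "i < d" and t: "t \<in> T" for i t
  proof (rule bounded_mat_group_eigenvalue[OF bg])
    show "\<rho> t \<in> \<rho> ` T" using t by blast
    show c: "Matrix.col P i \<in> carrier_vec d" using P i by auto
    have "Q *\<^sub>v Matrix.col P i = Matrix.col (Q * P) i" using i P Q by (intro col_mult2[symmetric]) auto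
    then have "Q *\<^sub>v Matrix.col P i = unit_vec d i" unfolding QP using i by simp
    moreover have "Q *\<^sub>v 0\<^sub>v d = 0\<^sub>v d" using Q by (auto intro!: eq_vecI)
    moreover have "(unit_vec d i :: complex Matrix.vec) \<noteq> 0\<^sub>v d"
      using i by (metis index_unit_vec(1) index_zero_vec(1) one_neq_zero)
    ultimately show "Matrix.col P i \<noteq> 0\<^sub>v d" by metis
    show "\<rho> t *\<^sub>v Matrix.col P i = \<chi> i t \<cdot>\<^sub>v Matrix.col P i"
    proof -
      have "\<rho> t *\<^sub>v Matrix.col P i = Matrix.col (\<rho> t * P) i"
        using i P \<rho>[OF Tc[OF t]] by (intro col_mult2[symmetric]) auto
      also have "\<dots> = \<chi> i t \<cdot>\<^sub>v Matrix.col P i"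
        unfolding \<rho>P[OF t] D_def mat_diag_mult_right[OF P] using P i by (auto intro!: eq_vecI)
      finally show ?thesis .
    qed
  qed
  have \<chi>cont: "continuous_on UNIV (\<lambda>s. \<chi> i (H s))" if i: "i < d" and H: "H \<in> lie_alg G X T" for i H
  proof -
    note h = lie_algD[OF H sT]
    have entry: "continuous_on UNIV (\<lambda>s. \<rho> (H s) $$ (k, l))" if "k < d" "l < d" for k l
    proof -
      have "continuous_map X euclidean (\<lambda>g. \<rho> g $$ (k, l))" using rep that unfolding is_rep_def by blast
      then have "continuous_map euclideanreal euclidean ((\<lambda>g. \<rho> g $$ (k, l)) \<circ> H)"
        by (rule continuous_map_compose[OF h(3)])
      then show ?thesis by (simp add: comp_def)
    qed
    have "\<chi> i (H s) = (\<Sum>k\<in>{0..<d}. Q $$ (i, k) * (\<Sum>l\<in>{0..<d}. \<rho> (H s) $$ (k, l) * P $$ (l, i)))" for s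
      unfolding \<chi>_def using P Q \<rho>[OF Tc[OF h(1)[of s]]] i by (simp add: scalar_prod_def)
    moreover have "continuous_on UNIV
        (\<lambda>s. \<Sum>k\<in>{0..<d}. Q $$ (i, k) * (\<Sum>l\<in>{0..<d}. \<rho> (H s) $$ (k, l) * P $$ (l, i)))"
      by (intro continuous_on_sum continuous_on_mult continuous_on_const entry) auto
    ultimately show ?thesis by simp
  qed
  have "\<forall>i H. i < d \<longrightarrow> H \<in> lie_alg G X T \<longrightarrow>
      (\<exists>a. \<forall>s. \<chi> i (H s) = exp (2 * pi * \<i> * complex_of_real (a * s)))"
  proof (intro allI impI)
    fix i H assume i: "i < d" and H: "H \<in> lie_alg G X T"
    note h = lie_algD[OF H sT]
    obtain a where "\<And>s. \<chi> i (H s) = exp (2 * pi * \<i> * complex_of_real (a * s))"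
      using unitary_character_real[OF \<chi>cont[OF i H]] \<chi>mult[OF i h(1) h(1)] \<chi>unit[OF i h(1)] h(2)
      by metis
    then show "\<exists>a. \<forall>s. \<chi> i (H s) = exp (2 * pi * \<i> * complex_of_real (a * s))" by blast
  qed
  then obtain w0 where w0: "\<And>i H s. i < d \<Longrightarrow> H \<in> lie_alg G X T \<Longrightarrow>
      \<chi> i (H s) = exp (2 * pi * \<i> * complex_of_real (w0 i H * s))"
    by metis
  \<comment> \<open>Forms vanish outside the Lie algebra by convention.\<close>
  define w where "w i H = (if H \<in> lie_alg G X T then w0 i H else 0)" for i H
  have w: "\<chi> i (H s) = exp (2 * pi * \<i> * complex_of_real (w i H * s))"
    if "i < d" "H \<in> lie_alg G X T" for i H s
    using w0[OF that] that by (simp add: w_def)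
  have lattice: "w i \<in> weight_lattice G X T" if i: "i < d" for i
  proof -
    have "w i (lie_add G H K) = w i H + w i K" if H: "H \<in> lie_alg G X T" and K: "K \<in> lie_alg G X T" for H K
    proof (rule real_character_frequency_unique)
      fix s
      have "exp (2 * pi * \<i> * complex_of_real (w i (lie_add G H K) * s)) = \<chi> i (H s \<otimes>\<^bsub>G\<^esub> K s)"
        using w[OF i lie_add_in_lie_alg[OF top sT comm H K], of s] by (simp add: lie_add_def)
      also have "\<dots> = exp (2 * pi * \<i> * complex_of_real (w i H * s)) * exp (2 * pi * \<i> * complex_of_real (w i K * s))"
        using \<chi>mult[OF i lie_algD(1)[OF H sT] lie_algD(1)[OF K sT]] w[OF i H] w[OF i K] by simp
      also have "\<dots> = exp (2 * pi * \<i> * complex_of_real ((w i H + w i K) * s))"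
        unfolding exp_add[symmetric] distrib_right of_real_add distrib_left by (rule refl)
      finally show "exp (2 * pi * \<i> * complex_of_real (w i (lie_add G H K) * s))
          = exp (2 * pi * \<i> * complex_of_real ((w i H + w i K) * s))" .
    qed
    moreover have "w i (lie_scale c H) = c * w i H" if H: "H \<in> lie_alg G X T" for c H
    proof (rule real_character_frequency_unique)
      fix s
      have "exp (2 * pi * \<i> * complex_of_real (w i (lie_scale c H) * s)) = \<chi> i (H (c * s))"
        using w[OF i lie_scale_in_lie_alg[OF H, of c], of s] by (simp add: lie_scale_def)
      also have "\<dots> = exp (2 * pi * \<i> * complex_of_real (c * w i H * s))"
        using w[OF i H, of "c * s"] by (simp add: mult_ac)
      finally show "exp (2 * pi * \<i> * complex_of_real (w i (lie_scale c H) * s))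
          = exp (2 * pi * \<i> * complex_of_real (c * w i H * s))" .
    qed
    moreover have "w i H \<in> \<int>" if "H \<in> integral_lattice G X T" for H
    proof -
      have H: "H \<in> lie_alg G X T" "H 1 = \<one>\<^bsub>G\<^esub>"
        using that unfolding integral_lattice_def lie_exp_def by auto
      have "\<chi> i \<one>\<^bsub>G\<^esub> * \<chi> i \<one>\<^bsub>G\<^esub> = \<chi> i \<one>\<^bsub>G\<^esub>"
        using \<chi>mult[OF i subgroup.one_closed[OF sT] subgroup.one_closed[OF sT]] by simp
      then have "\<chi> i \<one>\<^bsub>G\<^esub> = 1" using \<chi>unit[OF i subgroup.one_closed[OF sT]] by auto
      then have "exp (2 * pi * \<i> * complex_of_real (w i H)) = 1" using w[OF i H(1), of 1] H(2) by simp
      then have "\<exists>k::int. 2 * pi * w i H = of_int (2 * k) * pi" unfolding exp_eq_1 by simp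
      then obtain k :: int where "2 * pi * w i H = of_int (2 * k) * pi" by blast
      then have "w i H = of_int k" by simp
      then show ?thesis by simp
    qed
    ultimately show ?thesis unfolding weight_lattice_def lie_dual_def by (auto simp: w_def)
  qed
  have "\<rho> (lie_exp H) = P * mat_diag d (\<lambda>i. exp (2 * pi * \<i> * complex_of_real (w i H))) * Q"
    if H: "H \<in> lie_alg G X T" for H
  proof -
    have "D (H 1) = mat_diag d (\<lambda>i. exp (2 * pi * \<i> * complex_of_real (w i H)))"
      unfolding D_def using w[OF _ H, of _ 1] by (intro eq_matI) (auto simp: mat_diag_def)
    then show ?thesis using \<rho>D[OF lie_algD(1)[OF H sT, of 1]] by (simp add: lie_exp_def)
  qed
  then show thesis using that P Q PQ QP lattice by blast
qed

section \<open>Convergence to the mean weight\<close>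

text \<open>
  This is how a weight below \<open>\<lambda>\<close> in the sense of \<^const>\<open>weight_le\<close> comes to lie in the weight polytope of \<open>\<lambda>\<close>.
\<close>

lemma in_own_weight_polytope:
  assumes G: "Group.group G" and T: "subgroup T G" and \<mu>: "\<mu> \<in> lie_dual G X T"
  shows "\<mu> \<in> weight_polytope G X T \<mu>"
proof -
  interpret group G by (rule G)
  have Tc: "t \<in> carrier G" if "t \<in> T" for t using subgroup.mem_carrier[OF T that] .
  have "\<one>\<^bsub>G\<^esub> \<in> normalizer G T"
    unfolding normalizer_def stabilizer_def using coset_mult_one[of T] lcos_mult_one[of T] Tc
    by (auto simp: subsetI)
  moreover have "coadjoint G X T \<one>\<^bsub>G\<^esub> \<mu> = \<mu>"
  proof
    fix H
    show "coadjoint G X T \<one>\<^bsub>G\<^esub> \<mu> H = \<mu> H"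
    proof (cases "H \<in> lie_alg G X T")
      case True
      then have "H s \<in> carrier G" for s using Tc lie_algD(1)[OF True T] by blast
      then show ?thesis using True by (simp add: coadjoint_def)
    qed (use \<mu> in \<open>auto simp: coadjoint_def lie_dual_def\<close>)
  qed
  ultimately have "\<mu> \<in> weyl_orbit G X T \<mu>" unfolding weyl_orbit_def by (metis image_eqI)
  then show ?thesis unfolding weight_polytope_def by (rule form_hull_gen)
qed

theorem theorem1:
  fixes G :: "'g monoid" and X :: "'g topology" and n :: nat and \<A> :: "'g chart set"
    and T :: "'g set" and C :: "('g ops \<Rightarrow> real) set" and lam :: "'g ops \<Rightarrow> real"
    and d :: nat and \<rho> :: "'g \<Rightarrow> complex Matrix.mat"
  assumes "lie_group G X n \<A>" and "compact_space X" and "connected_space X"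
    and "maximal_torus G X T"
    and "weyl_chamber G X n \<A> T C"
    and "lam \<in> dominant_weights G X T C" and "lam \<in> C"
    and "irreducible_rep G X d \<rho>" and "is_highest_weight G X T C d \<rho> lam"
  shows "(\<forall>N\<ge>1. prob_space (weight_measure G X T d \<rho> lam N)) \<and>
         weakly_converges_on (lie_dual G X T) (weight_measure G X T d \<rho> lam)
           (return (dual_borel G X T) (mean_weight G X T d \<rho>))"
proof -
  have top: "topological_group G X" using assms(1) unfolding lie_group_def by blast
  then have G: "Group.group G" unfolding topological_group_def by blast
  have T: "torus_in G X T" using assms(4) unfolding maximal_torus_def by blast
  then have sT: "subgroup T G" unfolding torus_in_def by blast
  have rep: "is_rep G X d \<rho>" and d: "d > 0" using assms(8) unfolding irreducible_rep_def by auto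
  obtain P Q w where P: "P \<in> carrier_mat d d" and Q: "Q \<in> carrier_mat d d"
    and PQ: "P * Q = 1\<^sub>m d" and QP: "Q * P = 1\<^sub>m d"
    and w: "\<And>i. i < d \<Longrightarrow> w i \<in> weight_lattice G X T"
    and \<rho>: "\<And>H. H \<in> lie_alg G X T \<Longrightarrow>
      \<rho> (lie_exp H) = P * mat_diag d (\<lambda>i. exp (2 * pi * \<i> * complex_of_real (w i H))) * Q"
    using torus_rep_weights[OF top assms(2) T rep] by blast
  define v where "v N = tensor_weight d w N" for N
  have wd: "w i \<in> lie_dual G X T" if "i < d" for i using w[OF that] by (simp add: weight_lattice_def)
  have v: "v N i \<in> weight_lattice G X T" if "i < d ^ N" for N i
    unfolding v_def using tensor_weight_in_weight_lattice[OF w that] .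
  have vd: "v N i \<in> lie_dual G X T" if "i < d ^ N" for N i using v[OF that] by (simp add: weight_lattice_def)
  have mult1: "weight_mult G X T d \<rho> \<nu> = card {i. i < d \<and> w i = \<nu>}" if "\<nu> \<in> lie_dual G X T" for \<nu>
    using weight_mult_diagonal[OF P Q PQ QP \<rho> wd that] .
  have mult: "weight_mult G X T (d ^ N) (tensor_power \<rho> N) \<nu> = card {i. i < d ^ N \<and> v N i = \<nu>}"
    if "\<nu> \<in> lie_dual G X T" for N \<nu>
  proof (rule weight_mult_diagonal[OF _ _ _ _ _ vd that])
    show "kronecker_power P N \<in> carrier_mat (d ^ N) (d ^ N)" "kronecker_power Q N \<in> carrier_mat (d ^ N) (d ^ N)"
      using P Q by simp_all
    show "kronecker_power P N * kronecker_power Q N = 1\<^sub>m (d ^ N)"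
      "kronecker_power Q N * kronecker_power P N = 1\<^sub>m (d ^ N)"
      using kronecker_power_mult[OF P Q] kronecker_power_mult[OF Q P] PQ QP
      by (simp_all add: kronecker_power_one)
    show "tensor_power \<rho> N (lie_exp H) = kronecker_power P N *
        mat_diag (d ^ N) (\<lambda>i. exp (2 * pi * \<i> * complex_of_real (v N i H))) * kronecker_power Q N"
      if H: "H \<in> lie_alg G X T" for H
      unfolding tensor_power_eq \<rho>[OF H] v_def kronecker_power_mat_diag[symmetric]
      by (subst kronecker_power_mult[OF mult_carrier_mat[OF P mat_diag_dim] Q],
          subst kronecker_power_mult[OF P mat_diag_dim]) (rule refl)
  qed
  have wweight: "w i \<in> weights G X T d \<rho>" if i: "i < d" for i
  proof -
    have "card {j. j < d \<and> w j = w i} \<noteq> 0" using i by (auto simp: card_eq_0_iff)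
    then show ?thesis
      unfolding weights_def mem_Collect_eq mult1[OF wd[OF i]] using w[OF i] by blast
  qed
  have whull: "w i \<in> form_hull (weyl_orbit G X T lam)" if i: "i < d" for i
    using assms(9) wweight[OF i] in_own_weight_polytope[OF G sT wd[OF i]]
    unfolding is_highest_weight_def weight_le_def weight_polytope_def by blast
  define A where "A N = weight_polytope G X T (form_scale (real N) lam) \<inter> weight_lattice G X T" for N
  have vA: "v N i \<in> A N" if N: "N \<ge> 1" and i: "i < d ^ N" for N i
  proof -
    obtain a where a: "a \<in> form_hull (weyl_orbit G X T lam)" "v N i = form_scale (real N) a"
      using tensor_weight_in_hull[where w = w, OF d whull i] unfolding v_def by blast
    then have "v N i \<in> weight_polytope G X T (form_scale (real N) lam)"
      unfolding weight_polytope_def weyl_orbit_scale using form_hull_scale[OF a(1), of "real N"] N by simp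
    then show ?thesis unfolding A_def using v[OF i] by simp
  qed
  \<comment> \<open>From here on \<open>v N\<close> is a random variable on the uniform space of basis vectors of the tensor power.\<close>
  define U where "U N = uniform_count_measure {..<d ^ N}" for N
  define x where "x N i = form_scale (1 / real N) (v N i)" for N i
  have xd: "x N i \<in> lie_dual G X T" if "i < d ^ N" for N i
    unfolding x_def by (rule form_scale_in_lie_dual[OF vd[OF that]])
  have xmeas: "x N \<in> U N \<rightarrow>\<^sub>M dual_borel G X T" for N
    unfolding U_def dual_borel_def using xd
    by (auto simp: measurable_def sets_uniform_count_measure space_uniform_count_measure space_restrict_space)
  have law: "weight_measure G X T d \<rho> lam N = distr (U N) (dual_borel G X T) (x N)" if N: "N \<ge> 1" for N
  proof -
    have "point_measure (A N) (\<lambda>\<nu>. ennreal (real (weight_mult G X T (d ^ N) (tensor_power \<rho> N) \<nu>) / real d ^ N))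
        = point_measure (A N) (\<lambda>\<nu>. ennreal (real (card {i\<in>{..<d ^ N}. v N i = \<nu>}) / real (card {..<d ^ N})))"
      unfolding point_measure_def
      by (rule density_cong, simp, simp, rule AE_I2)
        (use mult in \<open>simp add: A_def weight_lattice_def\<close>)
    also have "\<dots> = distr (U N) (count_space (A N)) (v N)"
      unfolding U_def using vA[OF N] by (intro point_measure_multiplicity) auto
    finally have "weight_measure G X T d \<rho> lam N
        = distr (distr (U N) (count_space (A N)) (v N)) (dual_borel G X T) (form_scale (1 / real N))"
      unfolding weight_measure_def A_def by simp
    also have "\<dots> = distr (U N) (dual_borel G X T) (form_scale (1 / real N) \<circ> v N)"
    proof (rule distr_distr)
      show "form_scale (1 / real N) \<in> count_space (A N) \<rightarrow>\<^sub>M dual_borel G X T"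
        unfolding dual_borel_def A_def
        by (auto simp: space_restrict_space weight_lattice_def form_scale_in_lie_dual)
      show "v N \<in> U N \<rightarrow>\<^sub>M count_space (A N)"
        unfolding U_def using vA[OF N]
        by (auto simp: measurable_def sets_uniform_count_measure space_uniform_count_measure)
    qed
    finally show ?thesis unfolding x_def comp_def .
  qed
  have prob: "prob_space (weight_measure G X T d \<rho> lam N)" if N: "N \<ge> 1" for N
  proof -
    have "prob_space (U N)" unfolding U_def using d by (intro prob_space_uniform_count_measure) (auto simp: lessThan_empty_iff)
    then show ?thesis unfolding law[OF N] using xmeas by (rule prob_space.prob_space_distr)
  qed
  have mean: "mean_weight G X T d \<rho> = (\<lambda>H. (\<Sum>i<d. w i H) / real d)"
  proof
    fix H
    have fin: "finite (w ` {..<d})" by simp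
    have W: "weights G X T d \<rho> = w ` {..<d}"
    proof
      show "w ` {..<d} \<subseteq> weights G X T d \<rho>" using wweight by auto
      show "weights G X T d \<rho> \<subseteq> w ` {..<d}"
      proof
        fix \<nu> assume "\<nu> \<in> weights G X T d \<rho>"
        then have "\<nu> \<in> lie_dual G X T" "weight_mult G X T d \<rho> \<nu> \<noteq> 0"
          unfolding weights_def weight_lattice_def by auto
        then have "{i. i < d \<and> w i = \<nu>} \<noteq> {}" using mult1[of \<nu>] by (metis card.empty)
        then show "\<nu> \<in> w ` {..<d}" by auto
      qed
    qed
    have "(\<Sum>\<nu>\<in>w ` {..<d}. real (weight_mult G X T d \<rho> \<nu>) * \<nu> H)
        = (\<Sum>\<nu>\<in>w ` {..<d}. \<Sum>i\<in>{i\<in>{..<d}. w i = \<nu>}. w i H)"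
    proof (rule sum.cong[OF refl])
      fix \<nu> assume "\<nu> \<in> w ` {..<d}"
      then have "\<nu> \<in> lie_dual G X T" using wd by auto
      then show "real (weight_mult G X T d \<rho> \<nu>) * \<nu> H = (\<Sum>i\<in>{i\<in>{..<d}. w i = \<nu>}. w i H)"
        by (simp add: mult1)
    qed
    also have "\<dots> = (\<Sum>i<d. w i H)" by (rule sum.group) auto
    finally show "mean_weight G X T d \<rho> H = (\<Sum>i<d. w i H) / real d"
      unfolding mean_weight_def W by simp
  qed
  have mean_dual: "mean_weight G X T d \<rho> \<in> lie_dual G X T"
  proof -
    have "(\<lambda>H. (\<Sum>i<k. w i H)) \<in> lie_dual G X T" if "k \<le> d" for k
      using that
    proof (induction k)
      case 0
      show ?case unfolding lie_dual_def by simp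
    next
      case (Suc k)
      then show ?case using form_add_in_lie_dual[of "\<lambda>H. \<Sum>i<k. w i H" G X T "w k"] wd[of k]
        by (simp add: form_add_def)
    qed
    then have "form_scale (1 / real d) (\<lambda>H. \<Sum>i<d. w i H) \<in> lie_dual G X T"
      by (intro form_scale_in_lie_dual) simp
    then show ?thesis unfolding mean form_scale_def by simp
  qed
  have "weakly_converges_on (lie_dual G X T) (weight_measure G X T d \<rho> lam)
      (return (dual_borel G X T) (mean_weight G X T d \<rho>))"
    unfolding weakly_converges_on_def
  proof (intro allI impI, elim conjE)
    fix f :: "('g ops \<Rightarrow> real) \<Rightarrow> real"
    assume f: "continuous_on (lie_dual G X T) f" "bounded (f ` lie_dual G X T)"
    have fm: "f \<in> borel_measurable (dual_borel G X T)"
      unfolding dual_borel_def using f(1) by (rule borel_measurable_continuous_on_restrict)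
    have lim: "integral\<^sup>L (return (dual_borel G X T) (mean_weight G X T d \<rho>)) f = f (mean_weight G X T d \<rho>)"
      using mean_dual fm by (intro integral_return) (auto simp: dual_borel_def space_restrict_space)
    have int: "integral\<^sup>L (weight_measure G X T d \<rho> lam N) f = (\<Sum>i<d ^ N. f (x N i)) / real d ^ N"
      if N: "N \<ge> 1" for N
    proof -
      have "integral\<^sup>L (weight_measure G X T d \<rho> lam N) f = integral\<^sup>L (U N) (\<lambda>i. f (x N i))"
        unfolding law[OF N] by (rule integral_distr[OF xmeas fm])
      also have "\<dots> = (\<Sum>i<d ^ N. f (x N i)) / real (card {..<d ^ N})"
        unfolding U_def by (rule integral_uniform_count_measure) simp
      finally show ?thesis by simp
    qed
    have "(\<lambda>N. (\<Sum>i<d ^ N. f (x N i)) / real d ^ N) \<longlonglongrightarrow> f (mean_weight G X T d \<rho>)"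
      unfolding x_def v_def
      using tensor_weight_law_of_large_numbers[OF d mean_dual mean _ f] xd unfolding x_def v_def by blast
    moreover have "\<forall>\<^sub>F N in sequentially.
        (\<Sum>i<d ^ N. f (x N i)) / real d ^ N = integral\<^sup>L (weight_measure G X T d \<rho> lam N) f"
      using eventually_ge_at_top[of 1] by eventually_elim (simp add: int)
    ultimately show "(\<lambda>N. integral\<^sup>L (weight_measure G X T d \<rho> lam N) f)
        \<longlonglongrightarrow> integral\<^sup>L (return (dual_borel G X T) (mean_weight G X T d \<rho>)) f"
      unfolding lim by (rule Lim_transform_eventually)
  qed
  then show ?thesis using prob by blast
qed

end
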